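(* Let $\mathcal H$ denote either the Hardy space $H^2(\mathbb D)$ or a weighted Bergman space $A^2_\alpha(\mathbb D)$ with $\alpha>-1$. Suppose $\varphi$ and $\psi$ are linear-fractional self-maps of $\mathbb D$, neither of which is an automorphism of $\mathbb D$, such that for some $\zeta\in\partial\mathbb D$ we have $\varphi(\zeta)=\psi(\zeta)\in\partial\mathbb D$ and $\varphi'(\zeta)=\psi'(\zeta)$. If $\varphi\neq\psi$, then $C_\varphi-C_\psi$ is not compact on $\mathcal H$.
   Context: $\mathbb D$ is the open unit disk in $\mathbb C$. For an analytic map $\varphi:\mathbb D\to\mathbb D$, the composition operator is $C_\varphi f=f\circ\varphi$. $H^2(\mathbb D)$ is the space of analytic $f$ on $\mathbb D$ with $\|f\|^2=\lim_{r\to1^-}\int_0^{2\pi}|f(re^{i\theta})|^2\frac{d\theta}{2\pi}<\infty$; for $\alpha>-1$, $A^2_\alpha(\mathbb D)$ is the space of analytic $f$ on $\mathbb D$ with $\|f\|_\alpha^2=(\alpha+1)\int_{\mathbb D}|f(z)|^2(1-|z|^2)^\alpha\,dA(z)<\infty$, $dA$ normalized area measure. A linear-fractional self-map of $\mathbb D$ is a map $z\mapsto (az+b)/(cz+d)$ with $ad-bc\neq0$ mapping $\mathbb D$ into $\mathbb D$; such maps are analytic on a neighborhood of $\overline{\mathbb D}$. *)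

theory Defs
  imports "HOL-Analysis.Analysis"
begin

definition hardy_mean :: "(complex \<Rightarrow> complex) \<Rightarrow> real \<Rightarrow> real" where
  "hardy_mean f r = integral {0..2*pi} (\<lambda>t. (cmod (f (of_real r * cis t)))\<^sup>2) / (2*pi)"

definition in_H2 :: "(complex \<Rightarrow> complex) \<Rightarrow> bool" where
  "in_H2 f \<longleftrightarrow> f holomorphic_on ball 0 1 \<and> (\<exists>L. (hardy_mean f \<longlongrightarrow> L) (at_left 1))"

definition H2_norm :: "(complex \<Rightarrow> complex) \<Rightarrow> real" where
  "H2_norm f = sqrt (Lim (at_left 1) (hardy_mean f))"

section \<open>Weighted Bergman space A^2_alpha (dA = Lebesgue area measure / pi)\<close>

definition bergman_weight_fun :: "real \<Rightarrow> (complex \<Rightarrow> complex) \<Rightarrow> complex \<Rightarrow> real" where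
  "bergman_weight_fun \<alpha> f z = (cmod (f z))\<^sup>2 * (1 - (cmod z)\<^sup>2) powr \<alpha>"

definition in_A2 :: "real \<Rightarrow> (complex \<Rightarrow> complex) \<Rightarrow> bool" where
  "in_A2 \<alpha> f \<longleftrightarrow> f holomorphic_on ball 0 1 \<and>
      set_integrable lborel (ball 0 1) (bergman_weight_fun \<alpha> f)"

definition A2_norm :: "real \<Rightarrow> (complex \<Rightarrow> complex) \<Rightarrow> real" where
  "A2_norm \<alpha> f = sqrt ((\<alpha> + 1) / pi * (LINT z:ball 0 1|lborel. bergman_weight_fun \<alpha> f z))"

definition compact_op_on ::
  "((complex \<Rightarrow> complex) \<Rightarrow> bool) \<Rightarrow> ((complex \<Rightarrow> complex) \<Rightarrow> real)
    \<Rightarrow> ((complex \<Rightarrow> complex) \<Rightarrow> (complex \<Rightarrow> complex)) \<Rightarrow> bool" where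
  "compact_op_on mem nrm T \<longleftrightarrow>
     (\<forall>f. mem f \<longrightarrow> mem (T f)) \<and>
     (\<forall>fs :: nat \<Rightarrow> complex \<Rightarrow> complex. (\<forall>n. mem (fs n) \<and> nrm (fs n) \<le> 1) \<longrightarrow>
        (\<exists>r g. strict_mono r \<and> mem g \<and> (\<lambda>k. nrm (T (fs (r k)) - g)) \<longlonglongrightarrow> 0))"

definition comp_op :: "(complex \<Rightarrow> complex) \<Rightarrow> (complex \<Rightarrow> complex) \<Rightarrow> (complex \<Rightarrow> complex)" where
  "comp_op \<phi> f = f \<circ> \<phi>"

definition lf_selfmap :: "(complex \<Rightarrow> complex) \<Rightarrow> bool" where
  "lf_selfmap \<phi> \<longleftrightarrow> (\<exists>a b c d. a * d - b * c \<noteq> 0 \<and>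
       (\<forall>z. \<phi> z = (a * z + b) / (c * z + d))) \<and> \<phi> ` ball 0 1 \<subseteq> ball 0 1"

definition disc_automorphism :: "(complex \<Rightarrow> complex) \<Rightarrow> bool" where
  "disc_automorphism \<phi> \<longleftrightarrow> \<phi> holomorphic_on ball 0 1 \<and> bij_betw \<phi> (ball 0 1) (ball 0 1)"

end

theory Submission
  imports Defs "HOL-Complex_Analysis.Complex_Analysis"
begin

text \<open>Under Cayley transforms sending \<open>\<zeta>\<close> and \<open>\<phi> \<zeta>\<close> to infinity, the two maps become the affine self-maps
  \<open>u \<mapsto> s u + a\<close> and \<open>u \<mapsto> s u + b\<close> of the right half-plane, with the same \<open>s > 0\<close> because the derivatives at
  \<open>\<zeta>\<close> agree, and with \<open>a \<noteq> b\<close>. Let \<open>u\<close> tend to infinity along the line \<open>Re u = 1\<close>, i.e. let the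
  corresponding points \<open>w\<close> tend to \<open>\<zeta>\<close> along a horocycle. Then \<open>\<phi> w\<close> and \<open>\<psi> w\<close> stay at a pseudohyperbolic
  distance bounded below, and \<open>1 - \<bar>\<phi> w\<bar>\<close> is comparable to \<open>1 - \<bar>w\<bar>\<close>. Kernel functions \<open>f\<close> peaking at \<open>\<phi> w\<close> or
  \<open>\<psi> w\<close> are bounded in norm and tend to zero pointwise, while the value of \<open>f \<circ> \<phi> - f \<circ> \<psi>\<close> at \<open>w\<close> is
  comparable to the norm of the point evaluation at \<open>w\<close>; hence no subsequence of the images can converge in norm.\<close>

text \<open>Why a horocycle: the pseudohyperbolic distance of \<open>s u + a\<close> and
  \<open>s u + b\<close> is |a - b| over the modulus of the sum of one point and the conjugate of
  the other. Along a radius this sum grows and the two images become indistinguishable; on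
  \<open>Re u = 1\<close> it is constant. The kernel quotient
  \<open>(1 - |v|^2) / (1 - cnj v * v')\<close> measures how much of a peak at \<open>v\<close> is
  left at \<open>v'\<close>. Its power \<open>Suc n\<close> has to stay away from 1, so the limit
  must avoid roots of unity; modulus below 1 ensures this. It is obtained by peaking at the image
  whose translation constant has the smaller real part, which may belong to either map. The spaces
  enter only through an exponent \<gamma>, equal to 1 for H^2 and to \<alpha> + 2 for the Bergman
  spaces: a growth bound for point evaluations, bounded peak functions, and closure under
  differences. One inequality, the Poisson bound for |h|^2 on a circle, gives the growth bound in
  H^2 and, integrated over an annulus, in the Bergman spaces. The norm limit of the images is
  identified pointwise.\<close>

section \<open>Circle means and the Hardy space\<close>

text \<open>Cauchy's formula with \<open>z = r * cis t\<close>: since dz = i z dt, the kernel 1 / (z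
  - v) turns into 1 / (1 - v / z). This form pairs well with conjugates, as
  \<open>cnj z = r^2 / z\<close> on the circle.\<close>

lemma Cauchy_circle_mean:
  assumes g: "g holomorphic_on cball 0 r" and v: "cmod v < r"
  shows "((\<lambda>t. g (of_real r * cis t) / (1 - v / (of_real r * cis t)))
           has_integral (2 * of_real pi * g v)) {0..2*pi}"
proof -
  have r: "r > 0" using v norm_ge_zero[of v] by linarith
  have "((\<lambda>u. g u / (u - v)) has_contour_integral (2 * of_real pi * \<i> * g v)) (circlepath 0 r)"
    using assms by (intro Cauchy_integral_circlepath_simple) auto
  hence "((\<lambda>t. g (0 + r * cis t) / (0 + r * cis t - v) * r * \<i> * cis t)
           has_integral (2 * of_real pi * \<i> * g v)) {0..2*pi}"
    unfolding circlepath_def by (subst (asm) has_contour_integral_part_circlepath_iff) auto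
  hence "((\<lambda>t. -\<i> * (g (0 + r * cis t) / (0 + r * cis t - v) * r * \<i> * cis t))
           has_integral (-\<i> * (2 * of_real pi * \<i> * g v))) {0..2*pi}"
    by (rule has_integral_mult_right)
  moreover have "-\<i> * (g (0 + r * cis t) / (0 + r * cis t - v) * r * \<i> * cis t) =
      g (of_real r * cis t) / (1 - v / (of_real r * cis t))" for t
  proof -
    have nz: "of_real r * cis t \<noteq> 0" using r by simp
    have "1 - v / (of_real r * cis t) = (r * cis t - v) / (r * cis t)"
      using nz by (simp add: diff_divide_distrib)
    moreover have "-\<i> * (g (0 + r * cis t) / (0 + r * cis t - v) * r * \<i> * cis t) =
       (-\<i> * \<i>) * (g (r * cis t) * (r * cis t) / (r * cis t - v))" by (simp add: mult_ac)
    ultimately show ?thesis using nz by simp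
  qed
  moreover have "-\<i> * (2 * of_real pi * \<i> * g v) = 2 * of_real pi * g v"
    by (simp add: algebra_simps)
  ultimately show ?thesis by (simp only:)
qed

text \<open>Cauchy's formula for \<open>g z = 1 / (1 - a * z)\<close> at the point
  \<open>cnj a\<close>: on the unit circle \<open>1 - cnj a / z\<close> is the conjugate of
  \<open>1 - a * z\<close>, so the integrand is already a squared modulus.\<close>

lemma Szego_kernel_mean:
  assumes "cmod a < 1"
  shows "((\<lambda>t. 1 / (cmod (1 - a * cis t))\<^sup>2) has_integral (2 * pi / (1 - (cmod a)\<^sup>2))) {0..2*pi}"
proof -
  have nz: "1 - a * z \<noteq> 0" if "cmod z \<le> 1" for z
  proof
    assume "1 - a * z = 0"
    hence "a * z = 1" by simp
    hence "cmod a * cmod z = 1" by (metis norm_mult norm_one)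
    moreover have "cmod a * cmod z \<le> cmod a * 1" using that by (intro mult_left_mono) auto
    ultimately show False using assms by simp
  qed
  have "((\<lambda>t. (1 / (1 - a * (of_real 1 * cis t))) / (1 - cnj a / (of_real 1 * cis t)))
           has_integral (2 * of_real pi * (1 / (1 - a * cnj a)))) {0..2*pi}"
    using assms nz by (intro Cauchy_circle_mean holomorphic_intros) auto
  moreover have "(1 / (1 - a * (of_real 1 * cis t))) / (1 - cnj a / (of_real 1 * cis t)) =
      of_real (1 / (cmod (1 - a * cis t))\<^sup>2)" for t
  proof -
    have "cnj a / cis t = cnj (a * cis t)" by (simp add: divide_inverse cis_cnj)
    hence "1 - cnj a / cis t = cnj (1 - a * cis t)" by simp
    hence "(1 / (1 - a * cis t)) / (1 - cnj a / cis t) = 1 / ((1 - a * cis t) * cnj (1 - a * cis t))"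
      by (simp only: divide_divide_eq_left)
    thus ?thesis by (simp only: of_real_divide of_real_1 mult_1_left flip: complex_norm_square)
  qed
  moreover have "2 * of_real pi * (1 / (1 - a * cnj a)) = complex_of_real (2 * pi / (1 - (cmod a)\<^sup>2))"
    by (simp flip: complex_norm_square)
  ultimately show ?thesis
    using has_integral_Re[of "\<lambda>t. complex_of_real (1 / (cmod (1 - a * cis t))\<^sup>2)" "complex_of_real (2 * pi / (1 - (cmod a)\<^sup>2))"]
    by (simp only: Re_complex_of_real)
qed

text \<open>On the circle of radius \<open>s\<close> the Cauchy kernel times the holomorphic factor \<open>1 / (1 - cnj w z / s\<^sup>2)\<close> is
  the Poisson kernel up to normalisation.\<close>

lemma Poisson_integral_ineq:
  assumes h: "h holomorphic_on cball 0 s" and w: "cmod w < s"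
  shows "(cmod (h w))\<^sup>2 / (1 - (cmod w / s)\<^sup>2) \<le>
    integral {0..2*pi} (\<lambda>t. (cmod (h (of_real s * cis t)))\<^sup>2 / (cmod (1 - cnj w * cis t / of_real s))\<^sup>2) / (2*pi)"
proof -
  have s: "s > 0" using w norm_ge_zero[of w] by linarith
  define \<rho> where "\<rho> = cmod w / s"
  have \<rho>: "0 \<le> \<rho>" "\<rho> < 1" using w s by (auto simp: \<rho>_def)
  \<comment> \<open>Squaring \<open>h\<close> before taking absolute values keeps the integrand
    holomorphic, so the triangle inequality for integrals directly yields the bound for
    |h|^2.\<close>
  define g where "g z = (h z)\<^sup>2 / (1 - cnj w * z / (of_real s)\<^sup>2)" for z
  have nz: "1 - cnj w * z / (of_real s)\<^sup>2 \<noteq> 0" if "cmod z \<le> s" for z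
  proof
    assume "1 - cnj w * z / (of_real s)\<^sup>2 = 0"
    hence "cmod (cnj w * z / (of_real s)\<^sup>2) = 1" by simp
    hence "cmod w * cmod z = s\<^sup>2" using s by (simp add: norm_mult norm_divide norm_power field_simps)
    moreover have "cmod w * cmod z \<le> cmod w * s" using that by (intro mult_left_mono) auto
    moreover have "cmod w * s < s * s" using w s by simp
    ultimately show False by (simp add: power2_eq_square)
  qed
  have g: "g holomorphic_on cball 0 s"
    unfolding g_def using nz s by (intro holomorphic_intros h) auto
  let ?P = "\<lambda>t. (cmod (h (of_real s * cis t)))\<^sup>2 / (cmod (1 - cnj w * cis t / of_real s))\<^sup>2"
  have nz': "1 - cnj w * cis t / of_real s \<noteq> 0" for t
    using nz[of "s * cis t"] s by (simp add: norm_mult power2_eq_square)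
  have conth: "continuous_on {0..2*pi} (\<lambda>t. h (of_real s * cis t))"
    using s by (intro continuous_on_compose2[OF holomorphic_on_imp_continuous_on[OF h]] continuous_intros)
      (auto simp: norm_mult)
  have int: "?P integrable_on {0..2*pi}"
    using nz' s by (intro integrable_continuous_interval continuous_intros conth) auto
  have *: "((\<lambda>t. g (of_real s * cis t) / (1 - w / (of_real s * cis t))) has_integral (2 * of_real pi * g w)) {0..2*pi}"
    by (rule Cauchy_circle_mean[OF g w])
  have norm_eq: "cmod (g (of_real s * cis t) / (1 - w / (of_real s * cis t))) = ?P t" for t
  proof -
    have "w / (of_real s * cis t) = cnj (cnj w * cis t / of_real s)"
      using s by (simp add: divide_inverse cis_cnj)
    hence "1 - w / (of_real s * cis t) = cnj (1 - cnj w * cis t / of_real s)" by simp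
    hence "cmod (1 - w / (of_real s * cis t)) = cmod (1 - cnj w * cis t / of_real s)"
      by (simp only: complex_mod_cnj)
    moreover have "cnj w * (of_real s * cis t) / (of_real s)\<^sup>2 = cnj w * cis t / of_real s"
      using s by (simp add: power2_eq_square)
    ultimately show ?thesis
      by (simp only: g_def norm_divide norm_power) (simp add: power2_eq_square)
  qed
  have "cmod (2 * of_real pi * g w) \<le> integral {0..2*pi} ?P"
    using integral_norm_bound_integral[OF has_integral_integrable[OF *] int] norm_eq integral_unique[OF *]
    by simp
  moreover have "cmod (g w) = (cmod (h w))\<^sup>2 / (1 - \<rho>\<^sup>2)"
  proof -
    have "1 - cnj w * w / (of_real s)\<^sup>2 = of_real (1 - \<rho>\<^sup>2)"
      using complex_norm_square[of w] by (simp add: \<rho>_def power_divide mult.commute)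
    moreover have "1 - \<rho>\<^sup>2 > 0" using \<rho> by (simp add: power_less_one_iff abs_square_less_1)
    ultimately show ?thesis by (simp only: g_def norm_divide norm_power norm_of_real abs_of_pos)
  qed
  ultimately show ?thesis unfolding \<rho>_def[symmetric] by (simp add: norm_mult field_simps)
qed

text \<open>The kernel of \<open>Poisson_integral_ineq\<close> is replaced by its maximum on the
  circle; with \<rho> = |w| / s this leaves the factor (1 + \<rho>) / (1 - \<rho>), and the 2 is the
  bound for 1 + \<rho>.\<close>

lemma hardy_mean_eval:
  assumes h: "h holomorphic_on cball 0 s" and w: "cmod w < s"
  shows "(cmod (h w))\<^sup>2 * (s - cmod w) \<le> 2 * s * hardy_mean h s"
proof -
  have s: "s > 0" using w norm_ge_zero[of w] by linarith
  define \<rho> where "\<rho> = cmod w / s"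
  have \<rho>: "0 \<le> \<rho>" "\<rho> < 1" using w s by (auto simp: \<rho>_def)
  have low: "1 - \<rho> \<le> cmod (1 - cnj w * cis t / of_real s)" for t
    using norm_triangle_ineq2[of 1 "cnj w * cis t / of_real s"] s by (simp add: norm_mult norm_divide \<rho>_def)
  have conth: "continuous_on {0..2*pi} (\<lambda>t. h (of_real s * cis t))"
    using s by (intro continuous_on_compose2[OF holomorphic_on_imp_continuous_on[OF h]] continuous_intros)
      (auto simp: norm_mult)
  have nz: "1 - cnj w * cis t / of_real s \<noteq> 0" for t using low[of t] \<rho> by auto
  have "integral {0..2*pi} (\<lambda>t. (cmod (h (of_real s * cis t)))\<^sup>2 / (cmod (1 - cnj w * cis t / of_real s))\<^sup>2)
      \<le> integral {0..2*pi} (\<lambda>t. (cmod (h (of_real s * cis t)))\<^sup>2 / (1 - \<rho>)\<^sup>2)"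
    using nz s \<rho> low
    by (intro integral_le integrable_continuous_interval continuous_intros conth divide_left_mono power_mono) auto
  also have "\<dots> = integral {0..2*pi} (\<lambda>t. (cmod (h (of_real s * cis t)))\<^sup>2) / (1 - \<rho>)\<^sup>2"
    by simp
  finally have "(cmod (h w))\<^sup>2 / (1 - \<rho>\<^sup>2) \<le> hardy_mean h s / (1 - \<rho>)\<^sup>2"
    using Poisson_integral_ineq[OF assms] unfolding \<rho>_def[symmetric] hardy_mean_def
    by (smt (verit) divide_right_mono divide_divide_eq_left mult.commute pi_gt_zero)
  hence "(cmod (h w))\<^sup>2 * (1 - \<rho>)\<^sup>2 \<le> hardy_mean h s * ((1 - \<rho>) * (1 + \<rho>))"
  proof -
    have "1 - \<rho>\<^sup>2 > 0" "(1 - \<rho>)\<^sup>2 > 0" using \<rho> by (simp_all add: power_less_one_iff abs_square_less_1)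
    moreover have "1 - \<rho>\<^sup>2 = (1 - \<rho>) * (1 + \<rho>)" by (simp add: power2_eq_square algebra_simps)
    moreover have "x * b \<le> y * a" if "x / a \<le> y / b" "a > 0" "b > 0" for x y a b :: real
      using that by (simp add: field_simps)
    ultimately show ?thesis using \<open>(cmod (h w))\<^sup>2 / (1 - \<rho>\<^sup>2) \<le> hardy_mean h s / (1 - \<rho>)\<^sup>2\<close> by metis
  qed
  hence "(1 - \<rho>) * ((cmod (h w))\<^sup>2 * (1 - \<rho>)) \<le> (1 - \<rho>) * (hardy_mean h s * (1 + \<rho>))"
    by (simp add: power2_eq_square algebra_simps)
  hence "(cmod (h w))\<^sup>2 * (1 - \<rho>) \<le> hardy_mean h s * (1 + \<rho>)"
    using \<rho> by simp
  also have "\<dots> \<le> hardy_mean h s * 2"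
    using \<rho> by (intro mult_left_mono) (auto simp: hardy_mean_def
      intro!: divide_nonneg_pos Henstock_Kurzweil_Integration.integral_nonneg integrable_continuous_interval continuous_intros conth)
  finally have "(cmod (h w))\<^sup>2 * (1 - \<rho>) * s \<le> hardy_mean h s * 2 * s"
    using s by simp
  moreover have "(1 - \<rho>) * s = s - cmod w" using s by (simp add: \<rho>_def field_simps)
  ultimately show ?thesis by (simp add: mult.assoc) (simp add: mult_ac)
qed

text \<open>The Poisson inequality is integrated over the circle of radius \<open>r\<close> and the
  integrals are swapped. The kernel depends only on \<open>\<theta> - t\<close>, so its mean in
  \<open>t\<close> is the same as in \<open>\<theta>\<close> and cancels the normalisation.\<close>

lemma hardy_mean_mono:
  assumes h: "h holomorphic_on cball 0 s" and r: "0 \<le> r" "r < s"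
  shows "hardy_mean h r \<le> hardy_mean h s"
proof -
  have s: "s > 0" using r by linarith
  define \<rho> where "\<rho> = r / s"
  have \<rho>: "0 \<le> \<rho>" "\<rho> < 1" using r s by (auto simp: \<rho>_def)
  hence \<rho>2: "1 - \<rho>\<^sup>2 > 0" by (simp add: power_less_one_iff abs_square_less_1)
  have conth: "continuous_on A (\<lambda>x. h (of_real q * cis (f x)))" if "continuous_on A f" "0 \<le> q" "q \<le> s"
    for A and f :: "'a::topological_space \<Rightarrow> real" and q
    using s that by (intro continuous_on_compose2[OF holomorphic_on_imp_continuous_on[OF h]] continuous_intros)
      (auto simp: norm_mult)
  define K where "K \<theta> t = (cmod (h (of_real s * cis \<theta>)))\<^sup>2 / (cmod (1 - of_real \<rho> * cis (\<theta> - t)))\<^sup>2" for t \<theta>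
  have low: "1 - \<rho> \<le> cmod (1 - of_real \<rho> * cis t)" for t
    using norm_triangle_ineq2[of 1 "of_real \<rho> * cis t"] \<rho> by (simp add: norm_mult)
  have nz: "1 - of_real \<rho> * cis t \<noteq> 0" for t using low[of t] \<rho> by auto
  have contK: "continuous_on A (\<lambda>x. K (f x) (g x))" if "continuous_on A f" "continuous_on A g"
    for A and f g :: "'a::topological_space \<Rightarrow> real"
    unfolding K_def using nz r by (intro continuous_intros conth that) auto
  have pt: "(cmod (h (of_real r * cis t)))\<^sup>2 \<le> (1 - \<rho>\<^sup>2) / (2*pi) * integral {0..2*pi} (\<lambda>\<theta>. K \<theta> t)" for t
  proof -
    have "cnj (of_real r * cis t) * cis \<theta> / of_real s = of_real \<rho> * cis (\<theta> - t)" for \<theta>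
      by (simp add: \<rho>_def cis_cnj cis_divide[symmetric] divide_inverse)
    hence "(cmod (h (of_real r * cis t)))\<^sup>2 / (1 - \<rho>\<^sup>2) \<le> integral {0..2*pi} (\<lambda>\<theta>. K \<theta> t) / (2*pi)"
      using Poisson_integral_ineq[OF h, of "of_real r * cis t"] r unfolding K_def
      by (simp only: norm_mult norm_of_real norm_cis abs_of_nonneg mult_1_right \<rho>_def[symmetric])
    thus ?thesis using \<rho>2 by (simp add: field_simps)
  qed
  have inner: "integral {0..2*pi} (K \<theta>) = (cmod (h (of_real s * cis \<theta>)))\<^sup>2 * (2 * pi / (1 - \<rho>\<^sup>2))" for \<theta>
  proof -
    have eq: "cmod (1 - of_real \<rho> * cis (\<theta> - t)) = cmod (1 - (of_real \<rho> * cis (-\<theta>)) * cis t)" for t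
    proof -
      have "1 - of_real \<rho> * cis (\<theta> - t) = cnj (1 - (of_real \<rho> * cis (-\<theta>)) * cis t)"
        by (simp add: cis_cnj cis_mult mult.assoc)
      thus ?thesis by (simp only: complex_mod_cnj)
    qed
    have "((\<lambda>t. (cmod (h (of_real s * cis \<theta>)))\<^sup>2 * (1 / (cmod (1 - (of_real \<rho> * cis (-\<theta>)) * cis t))\<^sup>2))
        has_integral (cmod (h (of_real s * cis \<theta>)))\<^sup>2 * (2 * pi / (1 - (cmod (of_real \<rho> * cis (-\<theta>)))\<^sup>2))) {0..2*pi}"
      using \<rho> by (intro has_integral_mult_right Szego_kernel_mean) (auto simp: norm_mult)
    moreover have "K \<theta> = (\<lambda>t. (cmod (h (of_real s * cis \<theta>)))\<^sup>2 * (1 / (cmod (1 - (of_real \<rho> * cis (-\<theta>)) * cis t))\<^sup>2))"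
      by (simp add: fun_eq_iff K_def eq)
    ultimately show ?thesis by (simp only: integral_unique) (simp add: norm_mult)
  qed
  have "integral {0..2*pi} (\<lambda>t. (cmod (h (of_real r * cis t)))\<^sup>2)
     \<le> integral {0..2*pi} (\<lambda>t. (1 - \<rho>\<^sup>2) / (2*pi) * integral {0..2*pi} (\<lambda>\<theta>. K \<theta> t))"
  proof (intro integral_le pt integrable_continuous_interval)
    show "continuous_on {0..2*pi} (\<lambda>t. (cmod (h (of_real r * cis t)))\<^sup>2)"
      using r by (intro continuous_intros conth) auto
    have "continuous_on (cbox 0 (2*pi)) (\<lambda>t. integral (cbox 0 (2*pi)) (\<lambda>\<theta>. K \<theta> t))"
      by (rule integral_continuous_on_param) (auto simp: case_prod_unfold intro!: contK continuous_intros)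
    thus "continuous_on {0..2*pi} (\<lambda>t. (1 - \<rho>\<^sup>2) / (2*pi) * integral {0..2*pi} (\<lambda>\<theta>. K \<theta> t))"
      by (intro continuous_intros) auto
  qed
  also have "\<dots> = (1 - \<rho>\<^sup>2) / (2*pi) * integral (cbox 0 (2*pi)) (\<lambda>t. integral (cbox 0 (2*pi)) (\<lambda>\<theta>. K \<theta> t))"
    by simp
  also have "\<dots> = (1 - \<rho>\<^sup>2) / (2*pi) * integral (cbox 0 (2*pi)) (\<lambda>\<theta>. integral (cbox 0 (2*pi)) (K \<theta>))"
    by (subst integral_swap_continuous) (auto simp: case_prod_unfold intro!: contK continuous_intros)
  also have "\<dots> = (1 - \<rho>\<^sup>2) / (2*pi) * (integral {0..2*pi} (\<lambda>t. (cmod (h (of_real s * cis t)))\<^sup>2) * (2 * pi / (1 - \<rho>\<^sup>2)))"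
    using inner by simp
  also have "\<dots> = integral {0..2*pi} (\<lambda>t. (cmod (h (of_real s * cis t)))\<^sup>2)"
    using \<rho>2 by simp
  finally show ?thesis by (simp add: hardy_mean_def divide_right_mono)
qed

section \<open>Limits of circle means and the space H^2\<close>

text \<open>This holds for every function: where the integrand is not integrable, the integral is 0
  by convention.\<close>

lemma hardy_mean_nonneg: "hardy_mean h r \<ge> 0"
  by (cases "(\<lambda>t. (cmod (h (of_real r * cis t)))\<^sup>2) integrable_on {0..2*pi}")
     (auto simp: hardy_mean_def not_integrable_integral
       intro!: divide_nonneg_pos Henstock_Kurzweil_Integration.integral_nonneg)

lemma hardy_mean_le_limit:
  assumes h: "h holomorphic_on ball 0 1" and L: "(hardy_mean h \<longlongrightarrow> L) (at_left 1)"
    and r: "0 \<le> r" "r < 1"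
  shows "hardy_mean h r \<le> L"
proof (rule tendsto_lowerbound[OF L])
  show "\<forall>\<^sub>F s in at_left 1. hardy_mean h r \<le> hardy_mean h s"
    using eventually_at_left_real[OF r(2)]
  proof eventually_elim
    case (elim s)
    thus ?case using r by (intro hardy_mean_mono holomorphic_on_subset[OF h]) auto
  qed
qed auto

lemma hardy_mean_convergent:
  assumes h: "h holomorphic_on ball 0 1" and B: "\<And>r. 0 \<le> r \<Longrightarrow> r < 1 \<Longrightarrow> hardy_mean h r \<le> B"
  shows "\<exists>L. (hardy_mean h \<longlongrightarrow> L) (at_left 1)"
proof -
  define L where "L = (SUP r\<in>{0..<1}. hardy_mean h r)"
  have bdd: "bdd_above (hardy_mean h ` {0..<1})" using B by (intro bdd_aboveI[of _ B]) auto
  have "(hardy_mean h \<longlongrightarrow> L) (at_left 1)"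
  proof (rule increasing_tendsto)
    have "\<forall>\<^sub>F r in at_left 1. r \<in> {0<..<(1::real)}" by (rule eventually_at_left_real) auto
    thus "\<forall>\<^sub>F r in at_left 1. hardy_mean h r \<le> L"
      by eventually_elim (auto simp: L_def intro!: cSUP_upper bdd)
  next
    fix x assume "x < L"
    then obtain r where r: "0 \<le> r" "r < 1" "x < hardy_mean h r"
      unfolding L_def by (subst (asm) less_cSUP_iff[OF _ bdd]) auto
    show "\<forall>\<^sub>F s in at_left 1. x < hardy_mean h s"
      using eventually_at_left_real[OF r(2)]
    proof eventually_elim
      case (elim s)
      hence "hardy_mean h r \<le> hardy_mean h s"
        using r by (intro hardy_mean_mono holomorphic_on_subset[OF h]) auto
      thus ?case using r by simp
    qed
  qed
  thus ?thesis ..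
qed

text \<open>Limits of the means of \<open>F\<close> and \<open>G\<close> say nothing directly about
  a limit for \<open>F - G\<close>. Monotonicity reduces its existence to boundedness, which
  \<open>|x - y|^2 <= 2 |x|^2 + 2 |y|^2\<close> gives.\<close>

lemma in_H2_diff:
  assumes F: "in_H2 F" and G: "in_H2 G"
  shows "in_H2 (F - G)"
proof -
  from F G obtain LF LG where FG: "F holomorphic_on ball 0 1" "G holomorphic_on ball 0 1"
    and L: "(hardy_mean F \<longlongrightarrow> LF) (at_left 1)" "(hardy_mean G \<longlongrightarrow> LG) (at_left 1)"
    unfolding in_H2_def by blast
  have h: "(F - G) holomorphic_on ball 0 1"
    unfolding fun_diff_def by (intro holomorphic_intros FG)
  have "hardy_mean (F - G) r \<le> 2 * LF + 2 * LG" if r: "0 \<le> r" "r < 1" for r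
  proof -
    have cont: "continuous_on {0..2*pi} (\<lambda>t. f (of_real r * cis t))" if "f holomorphic_on ball 0 1" for f
      using r by (intro continuous_on_compose2[OF holomorphic_on_imp_continuous_on[OF that]] continuous_intros)
        (auto simp: norm_mult)
    have pt: "(cmod ((F - G) z))\<^sup>2 \<le> 2 * (cmod (F z))\<^sup>2 + 2 * (cmod (G z))\<^sup>2" for z
    proof -
      have "(cmod ((F - G) z))\<^sup>2 \<le> (cmod (F z) + cmod (G z))\<^sup>2"
        by (intro power_mono) (auto intro: norm_triangle_ineq4)
      thus ?thesis using sum_squares_bound[of "cmod (F z)" "cmod (G z)"]
        by (simp add: power2_eq_square algebra_simps)
    qed
    have "integral {0..2*pi} (\<lambda>t. (cmod ((F - G) (of_real r * cis t)))\<^sup>2) \<le>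
      integral {0..2*pi} (\<lambda>t. 2 * (cmod (F (of_real r * cis t)))\<^sup>2 + 2 * (cmod (G (of_real r * cis t)))\<^sup>2)"
      by (intro integral_le integrable_continuous_interval continuous_intros cont h FG pt)
    also have "\<dots> = 2 * integral {0..2*pi} (\<lambda>t. (cmod (F (of_real r * cis t)))\<^sup>2) +
        2 * integral {0..2*pi} (\<lambda>t. (cmod (G (of_real r * cis t)))\<^sup>2)"
      by (subst Henstock_Kurzweil_Integration.integral_add)
         (auto intro!: integrable_continuous_interval continuous_intros cont FG)
    finally have "hardy_mean (F - G) r \<le> 2 * hardy_mean F r + 2 * hardy_mean G r"
      unfolding hardy_mean_def by (simp add: field_simps)
    thus ?thesis using hardy_mean_le_limit[OF FG(1) L(1) r] hardy_mean_le_limit[OF FG(2) L(2) r] by linarith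
  qed
  thus ?thesis unfolding in_H2_def using h hardy_mean_convergent[OF h] by blast
qed

lemma H2_norm_square:
  assumes "(hardy_mean h \<longlongrightarrow> L) (at_left 1)"
  shows "(H2_norm h)\<^sup>2 = L"
proof -
  have "L \<ge> 0" using assms by (rule tendsto_lowerbound) (simp_all add: hardy_mean_nonneg)
  moreover have "Lim (at_left 1) (hardy_mean h) = L" by (rule tendsto_Lim[OF _ assms]) simp
  ultimately show ?thesis by (simp add: H2_norm_def)
qed

lemma H2_eval:
  assumes h: "in_H2 h" and w: "cmod w < 1"
  shows "(cmod (h w))\<^sup>2 * (1 - cmod w) \<le> 2 * (H2_norm h)\<^sup>2"
proof -
  from h obtain L where hol: "h holomorphic_on ball 0 1" and L: "(hardy_mean h \<longlongrightarrow> L) (at_left 1)"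
    unfolding in_H2_def by blast
  have "(cmod (h w))\<^sup>2 * (1 - cmod w) \<le> 2 * 1 * L"
  proof (rule tendsto_le)
    show "((\<lambda>s. 2 * s * hardy_mean h s) \<longlongrightarrow> 2 * 1 * L) (at_left 1)"
      by (intro tendsto_intros L)
    show "((\<lambda>s. (cmod (h w))\<^sup>2 * (s - cmod w)) \<longlongrightarrow> (cmod (h w))\<^sup>2 * (1 - cmod w)) (at_left 1)"
      by (intro tendsto_intros)
    show "\<forall>\<^sub>F s in at_left 1. (cmod (h w))\<^sup>2 * (s - cmod w) \<le> 2 * s * hardy_mean h s"
      using eventually_at_left_real[OF w]
    proof eventually_elim
      case (elim s)
      thus ?case by (intro hardy_mean_eval holomorphic_on_subset[OF hol]) auto
    qed
  qed auto
  thus ?thesis using H2_norm_square[OF L] by simp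
qed

section \<open>Peak functions and their size in H^2\<close>

text \<open>For \<open>\<gamma> = 1\<close>, \<open>n = 0\<close> this is the normalised Szego kernel; for \<open>\<gamma> = \<alpha> + 2\<close> and \<open>n\<close> large it is
  comparable to the normalised Bergman kernel but needs only an integral power.\<close>

definition peak_fun :: "real \<Rightarrow> nat \<Rightarrow> complex \<Rightarrow> complex \<Rightarrow> complex" where
  "peak_fun \<gamma> n v z = of_real ((1 - (cmod v)\<^sup>2) powr (real (Suc n) - \<gamma> / 2) / 2 ^ n) / (1 - cnj v * z) ^ Suc n"

lemma one_minus_cnj_mult_nonzero:
  assumes "cmod v < 1" "cmod z \<le> 1"
  shows "1 - cnj v * z \<noteq> 0"
proof
  assume "1 - cnj v * z = 0"
  hence "cmod (cnj v * z) = 1" by simp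
  moreover have "cmod v * cmod z \<le> cmod v * 1" using assms by (intro mult_left_mono) auto
  ultimately show False using assms by (simp add: norm_mult)
qed

lemma peak_fun_holomorphic:
  assumes "cmod v < 1"
  shows "peak_fun \<gamma> n v holomorphic_on ball 0 1"
  unfolding peak_fun_def using one_minus_cnj_mult_nonzero[OF assms] by (intro holomorphic_intros) auto

text \<open>The means are explicit by \<open>Szego_kernel_mean\<close> with
  \<open>a = cnj v * r\<close>, and they tend to 1.\<close>

lemma peak_fun_H2:
  assumes v: "cmod v < 1"
  shows "in_H2 (peak_fun 1 0 v)" "H2_norm (peak_fun 1 0 v) \<le> 1"
proof -
  have v2: "1 - (cmod v)\<^sup>2 > 0" using v by (simp add: abs_square_less_1)
  have mean: "hardy_mean (peak_fun 1 0 v) r = (1 - (cmod v)\<^sup>2) / (1 - (cmod v)\<^sup>2 * r\<^sup>2)"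
    if r: "0 < r" "r < 1" for r
  proof -
    have "cmod v * r < 1" using mult_strict_mono[of "cmod v" 1 r 1] v r by simp
    hence "((\<lambda>t. (1 - (cmod v)\<^sup>2) * (1 / (cmod (1 - (cnj v * of_real r) * cis t))\<^sup>2)) has_integral
       (1 - (cmod v)\<^sup>2) * (2 * pi / (1 - (cmod (cnj v * of_real r))\<^sup>2))) {0..2*pi}"
      using r by (intro has_integral_mult_right Szego_kernel_mean) (simp add: norm_mult)
    moreover have "(cmod (peak_fun 1 0 v (of_real r * cis t)))\<^sup>2 =
       (1 - (cmod v)\<^sup>2) * (1 / (cmod (1 - (cnj v * of_real r) * cis t))\<^sup>2)" for t
      using v2 by (simp add: peak_fun_def norm_divide power_divide powr_half_sqrt mult.assoc)
    ultimately show ?thesis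
      by (simp add: hardy_mean_def integral_unique norm_mult power_mult_distrib)
  qed
  have "((\<lambda>r. (1 - (cmod v)\<^sup>2) / (1 - (cmod v)\<^sup>2 * r\<^sup>2)) \<longlongrightarrow> (1 - (cmod v)\<^sup>2) / (1 - (cmod v)\<^sup>2 * 1\<^sup>2)) (at_left 1)"
    using v2 by (intro tendsto_intros) auto
  hence "((\<lambda>r. (1 - (cmod v)\<^sup>2) / (1 - (cmod v)\<^sup>2 * r\<^sup>2)) \<longlongrightarrow> 1) (at_left 1)"
    using v2 by simp
  moreover have "\<forall>\<^sub>F r in at_left (1::real). (1 - (cmod v)\<^sup>2) / (1 - (cmod v)\<^sup>2 * r\<^sup>2) = hardy_mean (peak_fun 1 0 v) r"
    using eventually_at_left_real[OF zero_less_one] by eventually_elim (simp add: mean)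
  ultimately have lim: "(hardy_mean (peak_fun 1 0 v) \<longlongrightarrow> 1) (at_left 1)"
    by (rule Lim_transform_eventually)
  thus "in_H2 (peak_fun 1 0 v)" unfolding in_H2_def using peak_fun_holomorphic[OF v] by blast
  show "H2_norm (peak_fun 1 0 v) \<le> 1"
    using H2_norm_square[OF lim] by (auto simp: power2_eq_1_iff)
qed

section \<open>Area integrals and the weighted Bergman spaces\<close>

text \<open>Uniqueness of Haar measure: the image measure is translation invariant and agrees with
  Lebesgue measure on the unit ball, so Fubini applied to the indicator of
  \<open>{(x, y). x \<in> A \<and> x - y \<in> ball 0 1}\<close> identifies the two.\<close>

lemma lborel_distr_linear_isometry:
  fixes f :: "'a::euclidean_space \<Rightarrow> 'a"
  assumes lin: "linear f" and norm: "\<And>x. norm (f x) = norm x"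
  shows "distr lborel borel f = lborel"
proof (rule measure_eqI)
  have [measurable]: "f \<in> borel_measurable borel"
    using lin by (intro borel_measurable_continuous_onI linear_continuous_on linear_conv_bounded_linear[THEN iffD1])
  let ?L = "lborel :: 'a measure" and ?N = "distr lborel borel f"
  interpret N: sigma_finite_measure ?N
  proof -
    show "sigma_finite_measure ?N"
    proof (standard, intro exI[of _ "range (\<lambda>n::nat. ball 0 (real n))"] conjI ballI)
      show "countable (range (\<lambda>n::nat. ball (0::'a) (real n)))" by simp
      show "range (\<lambda>n::nat. ball (0::'a) (real n)) \<subseteq> sets ?N" by auto
      show "\<Union> (range (\<lambda>n::nat. ball (0::'a) (real n))) = space ?N"
        using reals_Archimedean2 by auto
      fix X assume "X \<in> range (\<lambda>n::nat. ball (0::'a) (real n))"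
      then obtain n :: nat where X: "X = ball 0 (real n)" by auto
      have "f -` X = ball 0 (real n)" using norm by (auto simp: X)
      thus "emeasure ?N X \<noteq> \<infinity>"
        by (simp add: X emeasure_distr emeasure_ball)
    qed
  qed
  have N_shift: "(\<integral>\<^sup>+x. F (x + y) \<partial>?N) = (\<integral>\<^sup>+x. F x \<partial>?N)"
    if [measurable]: "F \<in> borel_measurable borel" for F y
  proof -
    obtain y' where y': "y = f y'"
      using linear_injective_imp_surjective[OF lin] linear_injective_0[OF lin] norm
      by (metis norm_eq_zero surjD)
    have "(\<integral>\<^sup>+x. F (x + y) \<partial>?N) = (\<integral>\<^sup>+x. F (f (y' + x)) \<partial>lborel)"
      by (simp add: nn_integral_distr y' linear_add[OF lin] add.commute)
    also have "\<dots> = (\<integral>\<^sup>+x. F (f x) \<partial>distr lborel borel ((+) y'))"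
      by (simp add: nn_integral_distr)
    also have "\<dots> = (\<integral>\<^sup>+x. F x \<partial>?N)"
      by (simp add: lborel_distr_plus nn_integral_distr)
    finally show ?thesis .
  qed
  have L_shift: "(\<integral>\<^sup>+y. F (x + y) \<partial>?L) = (\<integral>\<^sup>+y. F y \<partial>?L)"
    if [measurable]: "F \<in> borel_measurable borel" for F x
  proof -
    have "(\<integral>\<^sup>+y. F (x + y) \<partial>?L) = (\<integral>\<^sup>+y. F y \<partial>distr lborel borel ((+) x))"
      by (simp add: nn_integral_distr)
    thus ?thesis by (simp add: lborel_distr_plus)
  qed
  \<comment> \<open>The ball is symmetric, is its own preimage under \<open>f\<close>, and has
    volume neither zero nor infinite, so that it can be cancelled at the end.\<close>
  define B where "B = ball (0::'a) 1"
  have [measurable]: "B \<in> sets borel" by (simp add: B_def)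
  show "sets ?N = sets ?L" by simp
  fix A assume "A \<in> sets ?N"
  hence [measurable]: "A \<in> sets borel" by simp
  have ball: "(\<integral>\<^sup>+y. indicator B (x - y) \<partial>?L) = emeasure ?L B" for x
  proof -
    have "indicator B (x - y) = (indicator B (- x + y) :: ennreal)" for y
      by (simp add: indicator_def B_def dist_norm norm_minus_commute)
    thus ?thesis using L_shift[of "indicator B" "-x"] by simp
  qed
  have NB: "emeasure ?N B = emeasure ?L B"
  proof -
    have "f -` B = B" using norm by (auto simp: B_def)
    thus ?thesis by (simp add: emeasure_distr)
  qed
  have "emeasure ?N A * emeasure ?L B = (\<integral>\<^sup>+x. indicator A x * emeasure ?L B \<partial>?N)"
    by (simp add: nn_integral_multc)
  also have "\<dots> = (\<integral>\<^sup>+x. (\<integral>\<^sup>+y. indicator A x * indicator B (x - y) \<partial>?L) \<partial>?N)"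
    by (simp add: ball nn_integral_cmult)
  also have "\<dots> = (\<integral>\<^sup>+y. (\<integral>\<^sup>+x. indicator A x * indicator B (x - y) \<partial>?N) \<partial>?L)"
  proof -
    interpret pair_sigma_finite ?L ?N ..
    show ?thesis by (rule Fubini') measurable
  qed
  also have "\<dots> = (\<integral>\<^sup>+y. (\<integral>\<^sup>+x. indicator A (x + y) * indicator B x \<partial>?N) \<partial>?L)"
  proof (rule nn_integral_cong)
    fix y show "(\<integral>\<^sup>+x. indicator A x * indicator B (x - y) \<partial>?N) = (\<integral>\<^sup>+x. indicator A (x + y) * indicator B x \<partial>?N)"
      using N_shift[of "\<lambda>x. indicator A x * indicator B (x - y)" y] by simp
  qed
  also have "\<dots> = (\<integral>\<^sup>+x. (\<integral>\<^sup>+y. indicator A (x + y) * indicator B x \<partial>?L) \<partial>?N)"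
  proof -
    interpret pair_sigma_finite ?N ?L ..
    show ?thesis by (rule Fubini') measurable
  qed
  also have "\<dots> = (\<integral>\<^sup>+x. emeasure ?L A * indicator B x \<partial>?N)"
    by (simp add: nn_integral_multc L_shift[of "indicator A"])
  also have "\<dots> = emeasure ?L A * emeasure ?L B"
    by (simp add: nn_integral_cmult NB)
  finally have "emeasure ?N A * emeasure ?L B = emeasure ?L A * emeasure ?L B" .
  moreover have "emeasure ?L B \<noteq> 0" "emeasure ?L B \<noteq> \<infinity>"
    using less_imp_neq[OF unit_ball_vol_pos[of "real DIM('a)"]] by (simp_all add: B_def emeasure_ball)
  ultimately show "emeasure ?N A = emeasure ?L A"
    by (metis ennreal_mult_cancel_left infinity_ennreal_def mult.commute)
qed

text \<open>This takes the place of polar coordinates: rotations preserve Lebesgue measure, so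
  integrating over all of them only contributes the factor \<open>2*pi\<close>, and Tonelli exposes
  the circle integrals.\<close>

lemma nn_integral_rotation_mean:
  fixes F :: "complex \<Rightarrow> ennreal"
  assumes [measurable]: "F \<in> borel_measurable borel"
  shows "ennreal (2*pi) * (\<integral>\<^sup>+z. F z \<partial>lborel) =
    (\<integral>\<^sup>+z. (\<integral>\<^sup>+t. F (cis t * z) * indicator {0..2*pi} t \<partial>lborel) \<partial>lborel)"
proof -
  have rot: "(\<integral>\<^sup>+z. F (cis t * z) \<partial>lborel) = (\<integral>\<^sup>+z. F z \<partial>lborel)" for t
  proof -
    have "linear ((*) (cis t))" by (simp add: bounded_linear.linear bounded_linear_mult_right)
    hence "distr lborel borel ((*) (cis t)) = lborel"
      by (intro lborel_distr_linear_isometry) (auto simp: norm_mult)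
    thus ?thesis using nn_integral_distr[of "(*) (cis t)" lborel borel F] by simp
  qed
  have [measurable]: "cis \<in> borel_measurable borel"
    by (intro borel_measurable_continuous_onI continuous_intros)
  have "ennreal (2*pi) * (\<integral>\<^sup>+z. F z \<partial>lborel) =
     (\<integral>\<^sup>+t. (\<integral>\<^sup>+z. F (cis t * z) * indicator {0..2*pi} t \<partial>lborel) \<partial>lborel)"
    by (simp add: nn_integral_multc rot nn_integral_cmult) (simp add: mult.commute)
  also have "\<dots> = (\<integral>\<^sup>+z. (\<integral>\<^sup>+t. F (cis t * z) * indicator {0..2*pi} t \<partial>lborel) \<partial>lborel)"
    by (rule lborel_pair.Fubini') measurable
  finally show ?thesis .
qed

text \<open>The image of area on the disc under |z|^2 is pi times Lebesgue measure on [0, 1],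
  because the annulus x < |z|^2 < 1 has area pi (1 - x). Finite measures of the rays
  \<open>{x<..}\<close> determine the measure.\<close>

lemma nn_integral_radial_disc:
  fixes F :: "real \<Rightarrow> ennreal"
  assumes [measurable]: "F \<in> borel_measurable borel"
  shows "(\<integral>\<^sup>+z. F ((cmod z)\<^sup>2) * indicator (ball 0 1) z \<partial>lborel) =
    ennreal pi * (\<integral>\<^sup>+s. F s * indicator {0..1} s \<partial>lborel)"
proof -
  define M where "M = distr (density lborel (indicator (ball (0::complex) 1))) borel (\<lambda>z. (cmod z)\<^sup>2)"
  define N where "N = density lborel (\<lambda>s::real. ennreal pi * indicator {0..1} s)"
  have "M = N"
  proof (rule measure_eqI_lessThan)
    show "sets M = sets borel" "sets N = sets borel" by (simp_all add: M_def N_def)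
    fix x :: real
    let ?A = "{z \<in> ball (0::complex) 1. x < (cmod z)\<^sup>2}"
    have [measurable]: "?A \<in> sets borel" by measurable
    have M: "emeasure M {x<..} = emeasure lborel ?A"
    proof -
      have "emeasure M {x<..} = (\<integral>\<^sup>+z. indicator (ball 0 1) z * indicator ((\<lambda>z. (cmod z)\<^sup>2) -` {x<..}) z \<partial>lborel)"
        unfolding M_def by (subst emeasure_distr, measurable, subst emeasure_density)
          (auto intro!: measurable_sets_borel[where f="\<lambda>z. (cmod z)\<^sup>2" and M=borel] borel_measurable_indicator)
      also have "\<dots> = (\<integral>\<^sup>+z. indicator ?A z \<partial>lborel)"
        by (intro nn_integral_cong) (auto simp: indicator_def)
      finally show ?thesis by simp
    qed
    have N: "emeasure N {x<..} = ennreal pi * emeasure lborel ({0..1} \<inter> {x<..})"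
    proof -
      have "emeasure N {x<..} = (\<integral>\<^sup>+s. ennreal pi * indicator ({0..1} \<inter> {x<..}) s \<partial>lborel)"
        unfolding N_def by (subst emeasure_density) (auto intro!: nn_integral_cong simp: indicator_def)
      thus ?thesis by (simp add: nn_integral_cmult)
    qed
    consider "x < 0" | "0 \<le> x" "x < 1" | "x \<ge> 1" by linarith
    hence "emeasure lborel ?A = ennreal pi * emeasure lborel ({0..1} \<inter> {x<..}) \<and> emeasure lborel ?A < \<infinity>"
    proof cases
      case 1
      have "?A = ball 0 1" using 1 by (auto intro: less_le_trans)
      moreover have "{0..1} \<inter> {x<..} = {0..1}" using 1 by auto
      ultimately show ?thesis by (simp add: emeasure_ball eval_unit_ball_vol)
    next
      case 2
      have "?A = ball 0 1 - cball 0 (sqrt x)"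
        using 2 by (auto simp: not_le real_less_rsqrt intro: real_sqrt_less_iff[THEN iffD1] real_less_lsqrt)
           (metis abs_norm_cancel not_le real_sqrt_abs real_sqrt_less_iff)+
      moreover have "{0..1} \<inter> {x<..} = {x<..1}" using 2 by auto
      moreover have "emeasure lborel (ball (0::complex) 1 - cball 0 (sqrt x)) = ennreal (pi * (1 - x))"
      proof -
        have "sqrt x < 1" using 2 by simp
        hence "cball (0::complex) (sqrt x) \<subseteq> ball 0 1"
          using le_less_trans[of "cmod _" "sqrt x" 1] by (simp add: subset_iff)
        hence "emeasure lborel (ball (0::complex) 1 - cball 0 (sqrt x)) =
           emeasure lborel (ball (0::complex) 1) - emeasure lborel (cball (0::complex) (sqrt x))"
          by (intro emeasure_Diff) (auto simp: emeasure_cball 2)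
        thus ?thesis using 2
          by (simp add: emeasure_cball emeasure_ball eval_unit_ball_vol ennreal_minus algebra_simps)
      qed
      ultimately show ?thesis using 2 by (simp add: ennreal_mult ennreal_mult_less_top)
    next
      case 3
      have "(cmod z)\<^sup>2 \<le> x" if "cmod z < 1" for z
        using 3 that abs_square_less_1[of "cmod z"] by simp
      hence "?A = {}" by force
      moreover have "{0..1} \<inter> {x<..} = {}" using 3 by auto
      ultimately show ?thesis by (simp only:) simp
    qed
    thus "emeasure M {x<..} < \<infinity>" "emeasure M {x<..} = emeasure N {x<..}" using M N by auto
  qed
  have "(\<integral>\<^sup>+z. F ((cmod z)\<^sup>2) * indicator (ball 0 1) z \<partial>lborel) = (\<integral>\<^sup>+s. F s \<partial>M)"
  proof -
    have "(\<integral>\<^sup>+s. F s \<partial>M) = (\<integral>\<^sup>+z. F ((cmod z)\<^sup>2) \<partial>density lborel (indicator (ball 0 1)))"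
      unfolding M_def by (rule nn_integral_distr) measurable
    also have "\<dots> = (\<integral>\<^sup>+z. indicator (ball 0 1) z * F ((cmod z)\<^sup>2) \<partial>lborel)"
      by (rule nn_integral_density) (auto intro!: borel_measurable_indicator)
    finally show ?thesis by (simp add: mult.commute)
  qed
  also have "\<dots> = (\<integral>\<^sup>+s. ennreal pi * (F s * indicator {0..1} s) \<partial>lborel)"
    unfolding \<open>M = N\<close> by (simp add: N_def nn_integral_density mult_ac)
  finally show ?thesis by (simp add: nn_integral_cmult)
qed

section \<open>Weighted area integrals as averages of circle means, and the Bergman norm\<close>

lemma bergman_weight_measurable:
  assumes "f holomorphic_on ball 0 1"
  shows "(\<lambda>z. indicator (ball 0 1) z *\<^sub>R bergman_weight_fun \<alpha> f z) \<in> borel_measurable borel"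
proof (rule borel_measurable_continuous_on_indicator)
  have "1 - (cmod z)\<^sup>2 \<noteq> 0" if "cmod z < 1" for z using that by (simp add: abs_square_eq_1)
  thus "continuous_on (ball 0 1) (bergman_weight_fun \<alpha> f)"
    unfolding bergman_weight_fun_def
    by (intro continuous_intros holomorphic_on_imp_continuous_on[OF assms]) auto
qed auto

lemma bergman_weight_nonneg [simp]: "0 \<le> bergman_weight_fun \<alpha> f z"
  by (simp add: bergman_weight_fun_def)

lemma nn_integral_bergman_weight_measurable:
  assumes "f holomorphic_on ball 0 1"
  shows "(\<lambda>z. ennreal (bergman_weight_fun \<alpha> f z) * indicator (ball 0 1) z) \<in> borel_measurable borel"
proof -
  have "(\<lambda>z. ennreal (bergman_weight_fun \<alpha> f z) * indicator (ball 0 1) z) =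
     (\<lambda>z. ennreal (indicator (ball 0 1) z *\<^sub>R bergman_weight_fun \<alpha> f z))"
    by (auto simp: indicator_def fun_eq_iff)
  thus ?thesis using bergman_weight_measurable[OF assms] by simp
qed

text \<open>The weight is radial, so averaging over rotations affects |f|^2 alone. Both the growth
  bound and the norm of the peak functions are thereby reduced to circle means.\<close>

lemma nn_integral_bergman_mean:
  assumes f: "f holomorphic_on ball 0 1"
  shows "ennreal (2*pi) * (\<integral>\<^sup>+z. ennreal (bergman_weight_fun \<alpha> f z) * indicator (ball 0 1) z \<partial>lborel) =
    (\<integral>\<^sup>+z. ennreal ((1 - (cmod z)\<^sup>2) powr \<alpha> * integral {0..2*pi} (\<lambda>t. (cmod (f (cis t * z)))\<^sup>2))
       * indicator (ball 0 1) z \<partial>lborel)"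
proof -
  have inner: "(\<integral>\<^sup>+t. ennreal (bergman_weight_fun \<alpha> f (cis t * z)) * indicator (ball 0 1) (cis t * z)
      * indicator {0..2*pi} t \<partial>lborel)
    = ennreal ((1 - (cmod z)\<^sup>2) powr \<alpha> * integral {0..2*pi} (\<lambda>t. (cmod (f (cis t * z)))\<^sup>2))
       * indicator (ball 0 1) z" for z
  proof (cases "cmod z < 1")
    case True
    have "continuous_on {0..2*pi} (\<lambda>t. (cmod (f (cis t * z)))\<^sup>2)"
      using True by (intro continuous_intros continuous_on_compose2[OF holomorphic_on_imp_continuous_on[OF f]])
        (auto simp: norm_mult)
    hence "((\<lambda>t. (1 - (cmod z)\<^sup>2) powr \<alpha> * (cmod (f (cis t * z)))\<^sup>2) has_integral
        (1 - (cmod z)\<^sup>2) powr \<alpha> * integral {0..2*pi} (\<lambda>t. (cmod (f (cis t * z)))\<^sup>2)) {0..2*pi}"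
      by (intro has_integral_mult_right integrable_integral integrable_continuous_interval)
    from nn_integral_has_integral_lebesgue'[OF _ this] show ?thesis
      using True by (simp add: bergman_weight_fun_def norm_mult mult.commute)
  qed (auto simp: norm_mult)
  show ?thesis
    using nn_integral_rotation_mean[OF nn_integral_bergman_weight_measurable[OF f, of \<alpha>]]
    by (simp only: inner)
qed

text \<open>Passage from the Bochner integral in the definition to \<open>ennreal\<close>, where the
  later chains of estimates run without integrability conditions.\<close>

lemma A2_norm_square:
  assumes "in_A2 \<alpha> f" "\<alpha> > -1"
  shows "ennreal ((A2_norm \<alpha> f)\<^sup>2) = ennreal ((\<alpha> + 1) / pi) *
    (\<integral>\<^sup>+z. ennreal (bergman_weight_fun \<alpha> f z) * indicator (ball 0 1) z \<partial>lborel)"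
proof -
  let ?g = "\<lambda>z. indicator (ball 0 1) z *\<^sub>R bergman_weight_fun \<alpha> f z"
  have "integrable lborel ?g" using assms by (simp add: in_A2_def set_integrable_def)
  hence "(\<integral>\<^sup>+z. ennreal (?g z) \<partial>lborel) = ennreal (LINT z|lborel. ?g z)"
    by (intro nn_integral_eq_integral) auto
  moreover have "(\<integral>\<^sup>+z. ennreal (?g z) \<partial>lborel) =
      (\<integral>\<^sup>+z. ennreal (bergman_weight_fun \<alpha> f z) * indicator (ball 0 1) z \<partial>lborel)"
    by (intro nn_integral_cong) (auto simp: indicator_def)
  moreover have "(A2_norm \<alpha> f)\<^sup>2 = (\<alpha> + 1) / pi * (LINT z|lborel. ?g z)"
    unfolding A2_norm_def set_lebesgue_integral_def using assms(2)
    by (intro real_sqrt_pow2 mult_nonneg_nonneg integral_nonneg_AE) auto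
  moreover have "ennreal ((\<alpha> + 1) / pi * L) = ennreal ((\<alpha> + 1) / pi) * ennreal L" for L
    using assms(2) by (intro ennreal_mult') simp
  ultimately show ?thesis by (simp only:)
qed

lemma in_A2_iff_nn_integral:
  "in_A2 \<alpha> f \<longleftrightarrow> f holomorphic_on ball 0 1 \<and>
    (\<integral>\<^sup>+z. ennreal (bergman_weight_fun \<alpha> f z) * indicator (ball 0 1) z \<partial>lborel) < \<infinity>"
proof (cases "f holomorphic_on ball 0 1")
  case True
  have "(\<integral>\<^sup>+z. ennreal (norm (indicator (ball 0 1) z *\<^sub>R bergman_weight_fun \<alpha> f z)) \<partial>lborel) =
      (\<integral>\<^sup>+z. ennreal (bergman_weight_fun \<alpha> f z) * indicator (ball 0 1) z \<partial>lborel)"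
    by (intro nn_integral_cong) (auto simp: indicator_def)
  thus ?thesis using True bergman_weight_measurable[OF True, of \<alpha>]
    by (simp add: in_A2_def set_integrable_def integrable_iff_bounded)
qed (simp add: in_A2_def)

lemma in_A2_diff:
  assumes F: "in_A2 \<alpha> F" and G: "in_A2 \<alpha> G"
  shows "in_A2 \<alpha> (F - G)"
  unfolding in_A2_def
proof
  have FG: "F holomorphic_on ball 0 1" "G holomorphic_on ball 0 1" using F G by (auto simp: in_A2_def)
  show hol: "(F - G) holomorphic_on ball 0 1"
    unfolding fun_diff_def by (intro holomorphic_intros FG)
  have int: "integrable lborel (\<lambda>z. 2 * (indicator (ball 0 1) z *\<^sub>R bergman_weight_fun \<alpha> F z) +
      2 * (indicator (ball 0 1) z *\<^sub>R bergman_weight_fun \<alpha> G z))"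
    using F G unfolding in_A2_def set_integrable_def
    by (intro Bochner_Integration.integrable_add integrable_mult_right) auto
  show "set_integrable lborel (ball 0 1) (bergman_weight_fun \<alpha> (F - G))"
    unfolding set_integrable_def
  proof (rule Bochner_Integration.integrable_bound[OF int])
    show "(\<lambda>z. indicator (ball 0 1) z *\<^sub>R bergman_weight_fun \<alpha> (F - G) z) \<in> borel_measurable lborel"
      using bergman_weight_measurable[OF hol] by simp
    have pt: "bergman_weight_fun \<alpha> (F - G) z \<le> 2 * bergman_weight_fun \<alpha> F z + 2 * bergman_weight_fun \<alpha> G z" for z
    proof -
      have "(cmod ((F - G) z))\<^sup>2 \<le> (cmod (F z) + cmod (G z))\<^sup>2"
        by (intro power_mono) (auto intro: norm_triangle_ineq4)
      hence "(cmod ((F - G) z))\<^sup>2 \<le> 2 * (cmod (F z))\<^sup>2 + 2 * (cmod (G z))\<^sup>2"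
        using sum_squares_bound[of "cmod (F z)" "cmod (G z)"] by (simp add: power2_eq_square algebra_simps)
      from mult_right_mono[OF this, of "(1 - (cmod z)\<^sup>2) powr \<alpha>"] show ?thesis
        by (simp add: bergman_weight_fun_def algebra_simps)
    qed
    show "AE z in lborel. norm (indicator (ball 0 1) z *\<^sub>R bergman_weight_fun \<alpha> (F - G) z) \<le>
      norm (2 * (indicator (ball 0 1) z *\<^sub>R bergman_weight_fun \<alpha> F z) +
      2 * (indicator (ball 0 1) z *\<^sub>R bergman_weight_fun \<alpha> G z))"
      using pt by (intro AE_I2) (auto simp: indicator_def)
  qed
qed

text \<open>This is \<open>hardy_mean_eval\<close> on the circle through \<open>z\<close>, with the
  phase of \<open>z\<close> rotated away. The factor \<open>pi\<close> is the length
  \<open>2*pi\<close> divided by the 2 that remains after |z| is bounded by 1.\<close>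

lemma rotation_mean_eval:
  assumes h: "h holomorphic_on ball 0 1" and wz: "cmod w < cmod z" "cmod z < 1"
  shows "(cmod (h w))\<^sup>2 * (cmod z - cmod w) * pi \<le> integral {0..2*pi} (\<lambda>t. (cmod (h (cis t * z)))\<^sup>2)"
proof -
  have z0: "z \<noteq> 0" using wz by auto
  define u where "u = sgn z"
  have u: "cmod u = 1" using z0 by (simp add: u_def norm_sgn)
  hence "u \<noteq> 0" by auto
  have z: "z = of_real (cmod z) * u" using z0 by (simp add: u_def sgn_eq)
  define h' where "h' x = h (x * u)" for x
  have "h' holomorphic_on cball 0 (cmod z)"
    unfolding h'_def
    by (rule holomorphic_on_compose_gen[OF _ h, unfolded o_def]) (use u wz in \<open>auto intro!: holomorphic_intros simp: norm_mult\<close>)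
  hence "(cmod (h' (w / u)))\<^sup>2 * (cmod z - cmod (w / u)) \<le> 2 * cmod z * hardy_mean h' (cmod z)"
    by (rule hardy_mean_eval) (use u wz in \<open>simp add: norm_divide\<close>)
  hence "(cmod (h w))\<^sup>2 * (cmod z - cmod w) \<le> 2 * cmod z * hardy_mean h' (cmod z)"
    using u \<open>u \<noteq> 0\<close> by (simp add: h'_def norm_divide)
  also have "\<dots> \<le> 2 * 1 * hardy_mean h' (cmod z)"
    using wz by (intro mult_right_mono mult_left_mono hardy_mean_nonneg) auto
  also have "hardy_mean h' (cmod z) = integral {0..2*pi} (\<lambda>t. (cmod (h (cis t * z)))\<^sup>2) / (2*pi)"
  proof -
    have "h' (of_real (cmod z) * cis t) = h (cis t * z)" for t
      unfolding h'_def using z by (metis mult.assoc mult.commute)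
    thus ?thesis by (simp add: hardy_mean_def)
  qed
  finally show ?thesis by (simp add: field_simps)
qed

text \<open>The circle estimate is integrated over an annulus halfway between \<open>w\<close> and
  the boundary. With d = 1 - |w|, the weight contributes d^\<alpha>, the distance of the circles
  from |w| contributes d, and the width of the annulus another d.\<close>

lemma A2_eval:
  assumes \<alpha>: "\<alpha> > -1"
  shows "\<exists>C. \<forall>h w. in_A2 \<alpha> h \<longrightarrow> cmod w < 1 \<longrightarrow>
    (cmod (h w))\<^sup>2 * (1 - cmod w) powr (\<alpha> + 2) \<le> C * (A2_norm \<alpha> h)\<^sup>2"
proof -
  \<comment> \<open>On the annulus used below, 1 - |z|^2 lies between d/4 and d. For \<alpha> >= 0
    the lower end gives the factor (1/4)^\<alpha>, for negative \<alpha> the upper end gives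
    1.\<close>
  define c where "c = min 1 ((1/4) powr \<alpha>)"
  have c: "c > 0" by (simp add: c_def)
  have "(cmod (h w))\<^sup>2 * (1 - cmod w) powr (\<alpha> + 2) \<le> 16 / (c * (\<alpha> + 1)) * (A2_norm \<alpha> h)\<^sup>2"
    if h: "in_A2 \<alpha> h" and w: "cmod w < 1" for h w
  proof -
    have hol: "h holomorphic_on ball 0 1" using h by (simp add: in_A2_def)
    define d where "d = 1 - cmod w"
    have d: "0 < d" "d \<le> 1" using w by (auto simp: d_def)
    \<comment> \<open>The inner radius keeps |z| - |w| at least d/2, the outer one keeps 1 - |z| at
      least d/4.\<close>
    define A where "A = cball (0::complex) (1 - d/4) - cball 0 (1 - d/2)"
    define X where "X = c * d powr \<alpha> * ((cmod (h w))\<^sup>2 * (d/2) * pi)"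
    have X: "X \<ge> 0" using c d by (simp add: X_def)
    have low: "X \<le> (1 - (cmod z)\<^sup>2) powr \<alpha> * integral {0..2*pi} (\<lambda>t. (cmod (h (cis t * z)))\<^sup>2)"
      if "z \<in> A" for z
    proof -
      have z: "1 - d/2 < cmod z" "cmod z \<le> 1 - d/4" using that by (auto simp: A_def)
      have fac: "1 - (cmod z)\<^sup>2 = (1 - cmod z) * (1 + cmod z)" by (simp add: power2_eq_square algebra_simps)
      have "1 - (cmod z)\<^sup>2 \<ge> (d/4) * 1" unfolding fac using z d by (intro mult_mono) auto
      moreover have "1 - (cmod z)\<^sup>2 \<le> (d/2) * 2" unfolding fac using z d by (intro mult_mono) auto
      ultimately have b: "1/4 * d \<le> 1 - (cmod z)\<^sup>2" "1 - (cmod z)\<^sup>2 \<le> d" by auto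
      have weight: "c * d powr \<alpha> \<le> (1 - (cmod z)\<^sup>2) powr \<alpha>"
      proof (cases "\<alpha> \<ge> 0")
        case True
        have "c * d powr \<alpha> \<le> (1/4) powr \<alpha> * d powr \<alpha>" by (intro mult_right_mono) (auto simp: c_def)
        also have "\<dots> = (1/4 * d) powr \<alpha>" using d by (subst powr_mult) auto
        also have "\<dots> \<le> (1 - (cmod z)\<^sup>2) powr \<alpha>" using b d True by (intro powr_mono2) auto
        finally show ?thesis .
      next
        case False
        have "c * d powr \<alpha> \<le> 1 * d powr \<alpha>" by (intro mult_right_mono) (auto simp: c_def)
        also have "1 * d powr \<alpha> \<le> (1 - (cmod z)\<^sup>2) powr \<alpha>" using b d False by (simp add: powr_mono2')
        finally show ?thesis .
      qed
      have "d/2 \<le> cmod z - cmod w" using z by (simp add: d_def field_simps)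
      hence "(cmod (h w))\<^sup>2 * (d/2) * pi \<le> (cmod (h w))\<^sup>2 * (cmod z - cmod w) * pi"
        by (intro mult_right_mono mult_left_mono) auto
      also have "\<dots> \<le> integral {0..2*pi} (\<lambda>t. (cmod (h (cis t * z)))\<^sup>2)"
        using z d \<open>d/2 \<le> cmod z - cmod w\<close> by (intro rotation_mean_eval hol) linarith+
      finally have "(cmod (h w))\<^sup>2 * (d/2) * pi \<le> integral {0..2*pi} (\<lambda>t. (cmod (h (cis t * z)))\<^sup>2)" .
      thus ?thesis unfolding X_def using weight d c by (intro mult_mono) auto
    qed
    have [measurable]: "A \<in> sets borel" by (simp add: A_def)
    have areaA: "emeasure lborel A \<ge> ennreal (pi * d / 4)"
    proof -
      have "emeasure lborel A = emeasure lborel (cball (0::complex) (1 - d/4)) - emeasure lborel (cball (0::complex) (1 - d/2))"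
        unfolding A_def using d by (intro emeasure_Diff) (auto simp: emeasure_cball)
      also have "\<dots> = ennreal (pi * (1 - d/4)\<^sup>2 - pi * (1 - d/2)\<^sup>2)"
        using d by (simp add: emeasure_cball eval_unit_ball_vol ennreal_minus)
      also have "pi * (1 - d/4)\<^sup>2 - pi * (1 - d/2)\<^sup>2 = pi * (d/4 * (2 - 3*d/4))"
        by (simp add: power2_eq_square algebra_simps)
      finally have "emeasure lborel A = ennreal (pi * (d/4 * (2 - 3*d/4)))" .
      moreover have "pi * d / 4 \<le> pi * (d/4 * (2 - 3*d/4))"
        using d mult_left_mono[of 1 "2 - 3*d/4" "d/4"] by simp
      ultimately show ?thesis by (simp add: ennreal_leI)
    qed
    have "ennreal (X * (pi * d / 4)) \<le> ennreal X * emeasure lborel A"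
      unfolding ennreal_mult'[OF X] by (rule mult_left_mono[OF areaA]) simp
    also have "\<dots> = (\<integral>\<^sup>+z. ennreal X * indicator A z \<partial>lborel)"
      by (simp add: nn_integral_cmult)
    also have "\<dots> \<le> (\<integral>\<^sup>+z. ennreal ((1 - (cmod z)\<^sup>2) powr \<alpha> * integral {0..2*pi} (\<lambda>t. (cmod (h (cis t * z)))\<^sup>2))
       * indicator (ball 0 1) z \<partial>lborel)"
      using low d by (intro nn_integral_mono) (auto simp: indicator_def A_def intro!: ennreal_leI)
    also have "\<dots> = ennreal (2*pi) * (\<integral>\<^sup>+z. ennreal (bergman_weight_fun \<alpha> h z) * indicator (ball 0 1) z \<partial>lborel)"
      by (rule nn_integral_bergman_mean[OF hol, symmetric])
    finally have "ennreal ((\<alpha> + 1) / pi) * ennreal (X * (pi * d / 4)) \<le> ennreal ((\<alpha> + 1) / pi) *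
        (ennreal (2*pi) * (\<integral>\<^sup>+z. ennreal (bergman_weight_fun \<alpha> h z) * indicator (ball 0 1) z \<partial>lborel))"
      by (rule mult_left_mono) simp
    also have "\<dots> = ennreal (2 * pi * (A2_norm \<alpha> h)\<^sup>2)"
      using A2_norm_square[OF h \<alpha>] by (simp add: ennreal_mult' mult_ac)
    finally have "ennreal ((\<alpha> + 1) / pi * (X * (pi * d / 4))) \<le> ennreal (2 * pi * (A2_norm \<alpha> h)\<^sup>2)"
      using \<alpha> by (subst ennreal_mult') simp_all
    hence "(\<alpha> + 1) / pi * (X * (pi * d / 4)) \<le> 2 * pi * (A2_norm \<alpha> h)\<^sup>2"
      by (subst (asm) ennreal_le_iff) auto
    moreover have "(\<alpha> + 1) / pi * (X * (pi * d / 4)) = pi * ((\<alpha> + 1) * c / 8 * ((cmod (h w))\<^sup>2 * (d powr \<alpha> * d\<^sup>2)))"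
      by (simp add: X_def power2_eq_square field_simps)
    moreover have "d powr (\<alpha> + 2) = d powr \<alpha> * d\<^sup>2"
      using d by (simp add: powr_add)
    ultimately have "pi * ((\<alpha> + 1) * c / 8 * ((cmod (h w))\<^sup>2 * d powr (\<alpha> + 2))) \<le> pi * (2 * (A2_norm \<alpha> h)\<^sup>2)"
      by (simp only: mult.left_commute[of pi] mult.assoc)
    hence "(\<alpha> + 1) * c / 8 * ((cmod (h w))\<^sup>2 * d powr (\<alpha> + 2)) \<le> 2 * (A2_norm \<alpha> h)\<^sup>2"
      by (subst (asm) mult_le_cancel_left_pos) auto
    moreover have "y \<le> 16 / (c * (\<alpha> + 1)) * x" if "(\<alpha> + 1) * c / 8 * y \<le> 2 * x" for x y
    proof -
      have "c * (\<alpha> + 1) > 0" using c \<alpha> by simp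
      moreover have "y * (c * (\<alpha> + 1)) \<le> 16 * x" using that by (simp add: mult_ac)
      ultimately show ?thesis by (simp only: times_divide_eq_left pos_le_divide_eq)
    qed
    ultimately show ?thesis unfolding d_def by blast
  qed
  thus ?thesis by blast
qed

section \<open>Norm bound for the peak functions in the Bergman spaces\<close>

text \<open>The quotient (1 - s) / (1 - s x) has derivative -(1 - x) / (1 - s x)^2, so with the
  exponent \<alpha> + 2 in the denominator the integrand is, up to a constant, the derivative of the
  power \<alpha> + 1 of this quotient.\<close>

lemma has_integral_bergman_radial:
  fixes \<alpha> x :: real
  assumes \<alpha>: "\<alpha> > -1" and x: "0 \<le> x" "x < 1"
  shows "((\<lambda>s. (1 - s) powr \<alpha> / (1 - s * x) powr (\<alpha> + 2)) has_integral (1 / ((\<alpha> + 1) * (1 - x)))) {0..1}"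
proof -
  define F where "F s = - (((1 - s) / (1 - s * x)) powr (\<alpha> + 1) / ((\<alpha> + 1) * (1 - x)))" for s :: real
  have pos: "1 - s * x > 0" if "0 \<le> s" "s \<le> 1" for s
  proof -
    have "s * x \<le> 1 * x" using that x by (intro mult_right_mono) auto
    thus ?thesis using x by simp
  qed
  have "((\<lambda>s. (1 - s) powr \<alpha> / (1 - s * x) powr (\<alpha> + 2)) has_integral (F 1 - F 0)) {0..1}"
  \<comment> \<open>For negative \<alpha> the integrand is unbounded near s = 1, while
    \<open>F\<close> is continuous there because \<alpha> + 1 > 0; hence derivatives are taken in
    the interior only.\<close>
  proof (rule fundamental_theorem_of_calculus_interior)
    have "continuous_on {0..1} (\<lambda>s. ((1 - s) / (1 - s * x)) powr (\<alpha> + 1))"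
    proof (rule continuous_on_powr')
      show "continuous_on {0..1} (\<lambda>s. (1 - s) / (1 - s * x))"
        using pos by (intro continuous_intros) force
      show "\<forall>s\<in>{0..1}. 0 \<le> (1 - s) / (1 - s * x) \<and> ((1 - s) / (1 - s * x) = 0 \<longrightarrow> 0 < \<alpha> + 1)"
        using pos \<alpha> by (auto intro!: divide_nonneg_pos)
    qed simp
    thus "continuous_on {0..1} F"
      unfolding F_def using \<alpha> x by (intro continuous_on_minus continuous_on_divide continuous_on_const) auto
    fix s :: real assume s: "s \<in> {0<..<1}"
    hence p: "1 - s * x > 0" and q: "1 - s > 0" using pos[of s] by auto
    have "((\<lambda>s. (1 - s) / (1 - s * x)) has_real_derivative ((-1) * (1 - s * x) - (1 - s) * (- x)) / ((1 - s * x) * (1 - s * x))) (at s)"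
      using p by (auto intro!: derivative_eq_intros)
    hence "((\<lambda>s. (1 - s) / (1 - s * x)) has_real_derivative (- (1 - x) / (1 - s * x)\<^sup>2)) (at s)"
      by (simp add: power2_eq_square algebra_simps)
    from DERIV_fun_powr[OF this, of "\<alpha> + 1"]
    have "((\<lambda>s. ((1 - s) / (1 - s * x)) powr (\<alpha> + 1)) has_real_derivative
       (\<alpha> + 1) * ((1 - s) / (1 - s * x)) powr \<alpha> * (- (1 - x) / (1 - s * x)\<^sup>2)) (at s)"
      using p q by simp
    from DERIV_minus[OF DERIV_cdivide[OF this, of "(\<alpha> + 1) * (1 - x)"]]
    have "(F has_real_derivative - ((\<alpha> + 1) * ((1 - s) / (1 - s * x)) powr \<alpha> * (- (1 - x) / (1 - s * x)\<^sup>2) /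
         ((\<alpha> + 1) * (1 - x)))) (at s)"
      unfolding F_def .
    moreover have "- ((\<alpha> + 1) * ((1 - s) / (1 - s * x)) powr \<alpha> * (- (1 - x) / (1 - s * x)\<^sup>2) / ((\<alpha> + 1) * (1 - x)))
       = (1 - s) powr \<alpha> / (1 - s * x) powr (\<alpha> + 2)"
    proof -
      have cancel: "- (a * b * (- c / e) / (a * c)) = b / e" if "a \<noteq> 0" "c \<noteq> 0" for a b c e :: real
        using that by simp
      have "- ((\<alpha> + 1) * ((1 - s) / (1 - s * x)) powr \<alpha> * (- (1 - x) / (1 - s * x)\<^sup>2) / ((\<alpha> + 1) * (1 - x)))
         = ((1 - s) / (1 - s * x)) powr \<alpha> / (1 - s * x)\<^sup>2" using \<alpha> x by (intro cancel) auto
      also have "\<dots> = (1 - s) powr \<alpha> / (1 - s * x) powr (\<alpha> + 2)"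
        using p q by (simp add: powr_divide powr_add)
      finally show ?thesis .
    qed
    ultimately show "(F has_vector_derivative (1 - s) powr \<alpha> / (1 - s * x) powr (\<alpha> + 2)) (at s)"
      by (simp add: has_real_derivative_iff_has_vector_derivative)
  qed simp
  moreover have "F 1 - F 0 = 1 / ((\<alpha> + 1) * (1 - x))"
    using \<alpha> by (simp add: F_def)
  ultimately show ?thesis by simp
qed

text \<open>Of the \<open>Suc n\<close> kernel factors, \<open>n\<close> are bounded through |1 - a
  cis t| >= 1 - |a| >= D / 2, and the last is integrated exactly by
  \<open>Szego_kernel_mean\<close>. The divisor \<open>2 ^ n\<close> in \<open>peak_fun\<close> is
  there to cancel the resulting 2^(2n) after squaring.\<close>

lemma peak_fun_circle_mean:
  assumes v: "cmod v < 1" and z: "cmod z < 1"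
  shows "integral {0..2*pi} (\<lambda>t. (cmod (peak_fun \<gamma> n v (cis t * z)))\<^sup>2) \<le>
    (1 - (cmod v)\<^sup>2) powr (2 * real (Suc n) - \<gamma>) * (2 * pi / (1 - (cmod v)\<^sup>2 * (cmod z)\<^sup>2) ^ (2 * n + 1))"
proof -
  define a where "a = cnj v * z"
  define D where "D = 1 - (cmod a)\<^sup>2"
  have a: "cmod a < 1"
    using mult_strict_mono'[of "cmod v" 1 "cmod z" 1] assms by (simp add: a_def norm_mult)
  have v2: "1 - (cmod v)\<^sup>2 > 0" using v by (simp add: abs_square_less_1)
  have D: "D > 0" using a by (simp add: D_def abs_square_less_1)
  define c where "c = (1 - (cmod v)\<^sup>2) powr (real (Suc n) - \<gamma> / 2) / 2 ^ n"
  have c2: "c\<^sup>2 = (1 - (cmod v)\<^sup>2) powr (2 * real (Suc n) - \<gamma>) / 4 ^ n"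
  proof -
    have "((1 - (cmod v)\<^sup>2) powr (real (Suc n) - \<gamma> / 2))\<^sup>2 = (1 - (cmod v)\<^sup>2) powr (2 * real (Suc n) - \<gamma>)"
      using v2 by (simp add: powr_power algebra_simps)
    moreover have "((2::real) ^ n)\<^sup>2 = 4 ^ n" by (simp flip: power_mult power_mult_distrib add: power2_eq_square)
    ultimately show ?thesis by (simp add: c_def power_divide)
  qed
  have low: "D / 2 \<le> cmod (1 - a * cis t)" for t
  proof -
    have "D = (1 - cmod a) * (1 + cmod a)" by (simp add: D_def power2_eq_square algebra_simps)
    also have "\<dots> \<le> (1 - cmod a) * 2" using a by (intro mult_left_mono) auto
    finally have "D / 2 \<le> 1 - cmod a" by simp
    also have "\<dots> \<le> cmod (1 - a * cis t)"
      using norm_triangle_ineq2[of 1 "a * cis t"] by (simp add: norm_mult)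
    finally show ?thesis .
  qed
  have pt: "(cmod (peak_fun \<gamma> n v (cis t * z)))\<^sup>2 \<le> c\<^sup>2 * (2 / D) ^ (2 * n) * (1 / (cmod (1 - a * cis t))\<^sup>2)" for t
  proof -
    define q where "q = cmod (1 - a * cis t)"
    have q: "q > 0" "D / 2 \<le> q" using low[of t] D by (auto simp: q_def)
    have "(cmod (peak_fun \<gamma> n v (cis t * z)))\<^sup>2 = (c / q ^ Suc n)\<^sup>2"
    proof -
      have "cmod (peak_fun \<gamma> n v (cis t * z)) = \<bar>c\<bar> / q ^ Suc n"
        unfolding peak_fun_def c_def[symmetric] norm_divide norm_power norm_of_real q_def a_def
        by (simp add: mult_ac)
      thus ?thesis by (simp add: power_divide)
    qed
    also have "\<dots> = c\<^sup>2 * (1 / q) ^ (2 * n) * (1 / q\<^sup>2)"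
      by (simp add: power_divide power_mult_distrib power2_eq_square flip: power_add) (simp add: mult_2 power_add)
    also have "\<dots> \<le> c\<^sup>2 * (2 / D) ^ (2 * n) * (1 / q\<^sup>2)"
      using q D by (intro mult_right_mono mult_left_mono power_mono) (auto simp: field_simps)
    finally show ?thesis by (simp add: q_def)
  qed
  have "((\<lambda>t. c\<^sup>2 * (2 / D) ^ (2 * n) * (1 / (cmod (1 - a * cis t))\<^sup>2)) has_integral c\<^sup>2 * (2 / D) ^ (2 * n) * (2 * pi / D)) {0..2*pi}"
    unfolding D_def by (intro has_integral_mult_right Szego_kernel_mean a)
  moreover have "continuous_on {0..2*pi} (\<lambda>t. (cmod (peak_fun \<gamma> n v (cis t * z)))\<^sup>2)"
    by (intro continuous_intros continuous_on_compose2[OF holomorphic_on_imp_continuous_on[OF peak_fun_holomorphic[OF v]]])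
       (use z in \<open>auto simp: norm_mult\<close>)
  ultimately have "integral {0..2*pi} (\<lambda>t. (cmod (peak_fun \<gamma> n v (cis t * z)))\<^sup>2) \<le> c\<^sup>2 * (2 / D) ^ (2 * n) * (2 * pi / D)"
    using pt by (intro has_integral_le[OF integrable_integral[OF integrable_continuous_interval]]) auto
  also have "\<dots> = (1 - (cmod v)\<^sup>2) powr (2 * real (Suc n) - \<gamma>) * (2 * pi / D ^ (2 * n + 1))"
    by (simp add: c2 power_divide power_mult)
  finally show ?thesis by (simp add: D_def a_def norm_mult power_mult_distrib)
qed

text \<open>The condition on \<open>n\<close> makes the exponent 2n - 1 - \<alpha> nonnegative. That
  surplus power of 1 - x is bounded by the same power of D = 1 - s x, which lowers the exponent of D
  from 2n + 1 to \<alpha> + 2, where the radial integral is explicit.\<close>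

lemma peak_fun_A2:
  assumes \<alpha>: "\<alpha> > -1" and n: "\<alpha> + 2 \<le> 2 * real n + 1" and v: "cmod v < 1"
  shows "in_A2 \<alpha> (peak_fun (\<alpha> + 2) n v)" "A2_norm \<alpha> (peak_fun (\<alpha> + 2) n v) \<le> 1"
proof -
  let ?f = "peak_fun (\<alpha> + 2) n v"
  let ?I = "\<integral>\<^sup>+z. ennreal (bergman_weight_fun \<alpha> ?f z) * indicator (ball 0 1) z \<partial>lborel"
  define x where "x = (cmod v)\<^sup>2"
  have x: "0 \<le> x" "x < 1" using v by (auto simp: x_def abs_square_less_1)
  define W where "W s = (1 - s) powr \<alpha> / (1 - s * x) powr (\<alpha> + 2)" for s
  have [measurable]: "W \<in> borel_measurable borel" unfolding W_def by measurable
  have pt: "(1 - (cmod z)\<^sup>2) powr \<alpha> * integral {0..2*pi} (\<lambda>t. (cmod (?f (cis t * z)))\<^sup>2) \<le> 2 * pi * (1 - x) * W ((cmod z)\<^sup>2)"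
    if z: "cmod z < 1" for z
  proof -
    define s where "s = (cmod z)\<^sup>2"
    have s: "0 \<le> s" "s < 1" using z by (auto simp: s_def abs_square_less_1)
    define D where "D = 1 - s * x"
    have "s * x \<le> 1 * x" using s x by (intro mult_right_mono) auto
    hence D: "1 - x \<le> D" "D > 0" using x by (auto simp: D_def)
    have e: "(1 - x) powr (2 * real (Suc n) - (\<alpha> + 2)) = (1 - x) * (1 - x) powr (2 * real n - 1 - \<alpha>)"
      using x powr_add[of "1 - x" 1 "2 * real n - 1 - \<alpha>"] by (simp add: algebra_simps)
    have "(1 - x) powr (2 * real n - 1 - \<alpha>) \<le> D powr (2 * real n - 1 - \<alpha>)"
      using D x n by (intro powr_mono2) auto
    also have "\<dots> = D ^ (2 * n + 1) / D powr (\<alpha> + 2)"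
      using D by (simp add: powr_diff[symmetric] powr_realpow[symmetric] algebra_simps del: power_Suc)
    finally have key: "(1 - x) powr (2 * real n - 1 - \<alpha>) / D ^ (2 * n + 1) \<le> 1 / D powr (\<alpha> + 2)"
      using D by (simp add: divide_le_eq)
    have "integral {0..2*pi} (\<lambda>t. (cmod (?f (cis t * z)))\<^sup>2) \<le>
        (1 - x) * (1 - x) powr (2 * real n - 1 - \<alpha>) * (2 * pi / D ^ (2 * n + 1))"
      using peak_fun_circle_mean[OF v z, of "\<alpha> + 2" n] e by (simp add: x_def D_def s_def mult.commute)
    also have "\<dots> = 2 * pi * (1 - x) * ((1 - x) powr (2 * real n - 1 - \<alpha>) / D ^ (2 * n + 1))" by simp
    also have "\<dots> \<le> 2 * pi * (1 - x) * (1 / D powr (\<alpha> + 2))"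
      using key x by (intro mult_left_mono) auto
    finally have "(1 - s) powr \<alpha> * integral {0..2*pi} (\<lambda>t. (cmod (?f (cis t * z)))\<^sup>2) \<le>
       (1 - s) powr \<alpha> * (2 * pi * (1 - x) * (1 / D powr (\<alpha> + 2)))"
      by (intro mult_left_mono) auto
    thus ?thesis by (simp add: W_def s_def D_def mult_ac)
  qed
  have hol: "?f holomorphic_on ball 0 1" by (rule peak_fun_holomorphic[OF v])
  have "ennreal (2*pi) * ?I = (\<integral>\<^sup>+z. ennreal ((1 - (cmod z)\<^sup>2) powr \<alpha> * integral {0..2*pi} (\<lambda>t. (cmod (?f (cis t * z)))\<^sup>2))
       * indicator (ball 0 1) z \<partial>lborel)"
    by (rule nn_integral_bergman_mean[OF hol])
  also have "\<dots> \<le> (\<integral>\<^sup>+z. ennreal (2 * pi * (1 - x) * W ((cmod z)\<^sup>2)) * indicator (ball 0 1) z \<partial>lborel)"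
    using pt by (intro nn_integral_mono) (auto simp: indicator_def intro!: ennreal_leI)
  also have "\<dots> = ennreal pi * (\<integral>\<^sup>+s. ennreal (2 * pi * (1 - x) * W s) * indicator {0..1} s \<partial>lborel)"
    by (rule nn_integral_radial_disc) measurable
  also have "(\<integral>\<^sup>+s. ennreal (2 * pi * (1 - x) * W s) * indicator {0..1} s \<partial>lborel) =
      ennreal (2 * pi * (1 - x) * (1 / ((\<alpha> + 1) * (1 - x))))"
    unfolding W_def using x
    by (intro nn_integral_has_integral_lebesgue' has_integral_mult_right has_integral_bergman_radial \<alpha>) auto
  also have "2 * pi * (1 - x) * (1 / ((\<alpha> + 1) * (1 - x))) = 2 * pi / (\<alpha> + 1)" using x by simp
  also have "ennreal pi * ennreal (2 * pi / (\<alpha> + 1)) = ennreal (2 * pi) * ennreal (pi / (\<alpha> + 1))"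
    using \<alpha> by (simp flip: ennreal_mult' add: mult_ac)
  finally have I: "?I \<le> ennreal (pi / (\<alpha> + 1))"
    by (subst (asm) ennreal_mult_le_mult_iff) auto
  hence "?I < \<infinity>" by (rule le_less_trans) simp
  thus A2: "in_A2 \<alpha> ?f" using hol by (simp add: in_A2_iff_nn_integral)
  have "ennreal ((A2_norm \<alpha> ?f)\<^sup>2) \<le> ennreal ((\<alpha> + 1) / pi) * ennreal (pi / (\<alpha> + 1))"
    unfolding A2_norm_square[OF A2 \<alpha>] by (intro mult_left_mono I) auto
  also have "\<dots> = ennreal 1" using \<alpha> by (subst ennreal_mult[symmetric]) auto
  finally have "(A2_norm \<alpha> ?f)\<^sup>2 \<le> 1" by (subst (asm) ennreal_le_iff) auto
  thus "A2_norm \<alpha> ?f \<le> 1" by (simp add: abs_square_le_1 abs_le_iff)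
qed

section \<open>Linear-fractional self-maps in half-plane coordinates\<close>

text \<open>The inverse of the Cayley transform \<open>z \<mapsto> (\<zeta> + z) / (\<zeta> - z)\<close> from the disc onto the right half-plane,
  sending \<open>\<zeta>\<close> to infinity.\<close>

definition cayley_inv :: "complex \<Rightarrow> complex \<Rightarrow> complex" where
  "cayley_inv \<zeta> u = \<zeta> * (u - 1) / (u + 1)"

lemma Re_pos_add_one_nonzero: "Re u > 0 \<Longrightarrow> u + 1 \<noteq> 0"
  by (metis add_eq_0_iff less_asym minus_complex.simps(1) one_complex.simps(1) uminus_complex.simps(1) zero_less_one neg_0_less_iff_less)

text \<open>Up to one factor in \<open>p\<close> and one in \<open>q\<close>, the disc kernel
  becomes the half-plane kernel. Its denominator \<open>cnj p + q\<close> does not change when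
  \<open>p\<close> and \<open>q\<close> are shifted by the same imaginary amount, as happens along a
  horocycle.\<close>

lemma one_minus_cnj_cayley_inv:
  assumes "cmod \<zeta> = 1" "Re p > 0" "Re q > 0"
  shows "1 - cnj (cayley_inv \<zeta> p) * cayley_inv \<zeta> q = 2 * (cnj p + q) / (cnj (p + 1) * (q + 1))"
proof -
  have nz: "cnj (p + 1) \<noteq> 0" "q + 1 \<noteq> 0"
    using assms Re_pos_add_one_nonzero[of p] Re_pos_add_one_nonzero[of q] by (simp_all only: complex_cnj_zero_iff) auto
  have "cnj \<zeta> * \<zeta> = 1" using assms complex_norm_square[of \<zeta>] by (simp add: mult.commute)
  hence "cnj (cayley_inv \<zeta> p) * cayley_inv \<zeta> q = (cnj p - 1) * (q - 1) / (cnj (p + 1) * (q + 1))"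
    by (simp add: cayley_inv_def mult_ac)
  also have "1 - \<dots> = (cnj (p + 1) * (q + 1) - (cnj p - 1) * (q - 1)) / (cnj (p + 1) * (q + 1))"
    using nz by (simp add: diff_divide_distrib)
  also have "cnj (p + 1) * (q + 1) - (cnj p - 1) * (q - 1) = 2 * (cnj p + q)"
    by (simp add: algebra_simps)
  finally show ?thesis .
qed

lemma one_minus_norm_cayley_inv:
  assumes "cmod \<zeta> = 1" "Re p > 0"
  shows "1 - (cmod (cayley_inv \<zeta> p))\<^sup>2 = 4 * Re p / (cmod (p + 1))\<^sup>2"
proof -
  have "complex_of_real (1 - (cmod (cayley_inv \<zeta> p))\<^sup>2) = 1 - cnj (cayley_inv \<zeta> p) * cayley_inv \<zeta> p"
    using complex_norm_square[of "cayley_inv \<zeta> p"] by (simp add: mult.commute)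
  also have "\<dots> = 2 * (cnj p + p) / (cnj (p + 1) * (p + 1))"
    by (rule one_minus_cnj_cayley_inv[OF assms assms(2)])
  also have "\<dots> = complex_of_real (4 * Re p / (cmod (p + 1))\<^sup>2)"
  proof -
    have "cnj (p + 1) * (p + 1) = of_real ((cmod (p + 1))\<^sup>2)"
      by (simp only: complex_norm_square mult.commute[of "cnj _"])
    moreover have "cnj p + p = of_real (2 * Re p)" by (simp add: complex_eq_iff)
    ultimately show ?thesis by (simp only:) simp
  qed
  finally show ?thesis by (simp only: of_real_eq_iff)
qed

lemma norm_cayley_inv_less_one:
  assumes "cmod \<zeta> = 1" "Re p > 0"
  shows "cmod (cayley_inv \<zeta> p) < 1"
proof -
  have "4 * Re p / (cmod (p + 1))\<^sup>2 > 0"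
    using assms Re_pos_add_one_nonzero by (intro divide_pos_pos) auto
  hence "(cmod (cayley_inv \<zeta> p))\<^sup>2 < 1" using one_minus_norm_cayley_inv[OF assms] by linarith
  thus ?thesis by (simp add: abs_square_less_1)
qed

lemma cayley_inv_surj:
  assumes "cmod \<zeta> = 1" "cmod z < 1"
  shows "\<exists>u. Re u > 0 \<and> z = cayley_inv \<zeta> u"
proof -
  define u where "u = (\<zeta> + z) / (\<zeta> - z)"
  have nz: "\<zeta> - z \<noteq> 0" "\<zeta> \<noteq> 0" using assms by auto
  have "u + 1 = 2 * \<zeta> / (\<zeta> - z)" "u - 1 = 2 * z / (\<zeta> - z)"
    using nz by (simp_all add: u_def field_simps)
  hence z: "z = cayley_inv \<zeta> u" using nz by (simp add: cayley_inv_def)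
  have "Re u = Re ((\<zeta> + z) * cnj (\<zeta> - z)) / (cmod (\<zeta> - z))\<^sup>2"
    unfolding u_def by (subst complex_div_cnj) (simp only: Re_divide_of_real flip: of_real_power)
  moreover have "Re ((\<zeta> + z) * cnj (\<zeta> - z)) = (cmod \<zeta>)\<^sup>2 - (cmod z)\<^sup>2"
    unfolding cmod_power2 by (simp add: algebra_simps power2_eq_square)
  moreover have "(cmod \<zeta>)\<^sup>2 - (cmod z)\<^sup>2 > 0" using assms by (simp add: abs_square_less_1)
  ultimately have "Re u > 0" using nz by simp
  thus ?thesis using z by blast
qed

text \<open>Large positive \<open>u\<close> rule out a negative real part of \<open>s\<close>;
  points far out on the line \<open>Re u = 1\<close> rule out an imaginary part. The values of
  \<open>t\<close> are chosen to outweigh \<open>Re a\<close>.\<close>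

lemma affine_half_plane_slope:
  fixes s a :: complex
  assumes "\<And>u. Re u > 0 \<Longrightarrow> Re (s * u + a) > 0" and "s \<noteq> 0"
  shows "s = of_real (Re s)" "Re s > 0"
proof -
  have Re: "Re s \<ge> 0"
  proof (rule ccontr)
    assume "\<not> Re s \<ge> 0"
    hence n: "Re s < 0" by simp
    define t where "t = (\<bar>Re a\<bar> + 1) / (- Re s)"
    have "t > 0" using n unfolding t_def by (intro divide_pos_pos) auto
    hence "Re s * t + Re a > 0" using assms(1)[of "of_real t"] by simp
    moreover have "Re s * t = - (\<bar>Re a\<bar> + 1)" using n by (simp add: t_def)
    ultimately show False by linarith
  qed
  have Im: "Im s = 0"
  proof (rule ccontr)
    assume n: "Im s \<noteq> 0"
    define t where "t = (\<bar>Re a\<bar> + Re s + 1) / Im s"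
    have "Re s - Im s * t + Re a > 0" using assms(1)[of "Complex 1 t"] by simp
    moreover have "Im s * t = \<bar>Re a\<bar> + Re s + 1" using n by (simp add: t_def)
    ultimately show False by linarith
  qed
  show "s = of_real (Re s)" using Im by (simp add: complex_eq_iff)
  thus "Re s > 0" using Re \<open>s \<noteq> 0\<close> by (metis less_eq_real_def of_real_0)
qed

text \<open>The conjugated map is a Moebius map fixing infinity, hence affine. The identity linking
  \<open>s\<close> to the derivative at \<zeta> is what later forces two maps with equal first-order
  data to share the slope.\<close>

lemma lf_selfmap_half_plane:
  assumes lf: "lf_selfmap \<phi>" and \<zeta>: "cmod \<zeta> = 1" and \<eta>: "cmod (\<phi> \<zeta>) = 1"
  shows "\<exists>s a. s > 0 \<and> \<phi> \<zeta> = of_real s * \<zeta> * deriv \<phi> \<zeta> \<and>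
    (\<forall>u. Re u > 0 \<longrightarrow> Re (of_real s * u + a) > 0 \<and>
       \<phi> (cayley_inv \<zeta> u) = cayley_inv (\<phi> \<zeta>) (of_real s * u + a))"
proof -
  define \<eta> where "\<eta> = \<phi> \<zeta>"
  have \<eta>1: "cmod \<eta> = 1" using \<eta> by (simp add: \<eta>_def)
  from lf obtain a b c d where det: "a * d - b * c \<noteq> 0" and \<phi>: "\<And>z. \<phi> z = (a * z + b) / (c * z + d)"
    and self: "\<phi> ` ball 0 1 \<subseteq> ball 0 1" unfolding lf_selfmap_def by blast
  have nz: "\<zeta> \<noteq> 0" "\<eta> \<noteq> 0" using \<zeta> \<eta>1 by auto
  \<comment> \<open>Division by zero yields 0, so a pole at \<zeta> would give \<phi> \<zeta> = 0
    instead of a unimodular value.\<close>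
  have den: "c * \<zeta> + d \<noteq> 0" using nz \<phi>[of \<zeta>] by (auto simp: \<eta>_def)
  have fixp: "a * \<zeta> + b = \<eta> * (c * \<zeta> + d)" using den \<phi>[of \<zeta>] by (simp add: \<eta>_def)
  have det2: "(a - \<eta> * c) * (c * \<zeta> + d) = a * d - b * c"
  proof -
    have "(a - \<eta> * c) * (c * \<zeta> + d) = a * (c * \<zeta> + d) - c * (\<eta> * (c * \<zeta> + d))" by (simp add: algebra_simps)
    also have "\<dots> = a * d - b * c" unfolding fixp[symmetric] by (simp add: algebra_simps)
    finally show ?thesis .
  qed
  have nz2: "a - \<eta> * c \<noteq> 0" using det2 det by auto
  have der: "deriv \<phi> \<zeta> = (a * d - b * c) / (c * \<zeta> + d)\<^sup>2"
  proof -
    have "((\<lambda>z. (a * z + b) / (c * z + d)) has_field_derivative (a * (c * \<zeta> + d) - (a * \<zeta> + b) * c) / ((c * \<zeta> + d) * (c * \<zeta> + d))) (at \<zeta>)"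
      using den by (auto intro!: derivative_eq_intros)
    moreover have "\<phi> = (\<lambda>z. (a * z + b) / (c * z + d))" using \<phi> by (simp add: fun_eq_iff)
    ultimately have "deriv \<phi> \<zeta> = (a * (c * \<zeta> + d) - (a * \<zeta> + b) * c) / ((c * \<zeta> + d) * (c * \<zeta> + d))"
      by (simp add: DERIV_imp_deriv)
    thus ?thesis by (simp add: power2_eq_square algebra_simps)
  qed
  \<comment> \<open>The coefficients arise from (\<eta> + \<phi> z) / (\<eta> - \<phi> z) after
    numerator and denominator are multiplied by (c z + d) (u + 1).\<close>
  define s where "s = \<eta> * (c * \<zeta> + d) / (\<zeta> * (a - \<eta> * c))"
  define e where "e = (\<eta> * d + b - (\<eta> * c + a) * \<zeta>) / (2 * \<zeta> * (a - \<eta> * c))"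
  have s0: "s \<noteq> 0" using nz nz2 den by (simp add: s_def)
  have sd: "\<eta> = s * \<zeta> * deriv \<phi> \<zeta>"
    unfolding der det2[symmetric] s_def using nz nz2 den by (simp add: power2_eq_square)
  have main: "Re (s * u + e) > 0 \<and> \<phi> (cayley_inv \<zeta> u) = cayley_inv \<eta> (s * u + e)" if u: "Re u > 0" for u
  proof -
    define z where "z = cayley_inv \<zeta> u"
    have z1: "cmod z < 1" using norm_cayley_inv_less_one[OF \<zeta> u] by (simp add: z_def)
    hence "\<phi> z \<in> ball 0 1" using self by (auto simp: image_subset_iff)
    hence "cmod (\<phi> z) < 1" by simp
    then obtain p where p: "Re p > 0" "\<phi> z = cayley_inv \<eta> p" using cayley_inv_surj[OF \<eta>1] by blast
    have u1: "u + 1 \<noteq> 0" and p1: "p + 1 \<noteq> 0" using u p Re_pos_add_one_nonzero by auto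
    \<comment> \<open>At a pole the formula returns the harmless value 0, so the self-map property
      has to be violated at nearby points, where \<phi> is large.\<close>
    have zden: "c * z + d \<noteq> 0"
    proof
      assume z0: "c * z + d = 0"
      have "c \<noteq> 0" using z0 det by auto
      have az: "a * z + b \<noteq> 0"
      proof
        assume "a * z + b = 0"
        hence "b = - (a * z)" "d = - (c * z)" using z0 by (simp_all add: add_eq_0_iff)
        hence "a * d - b * c = 0" by simp
        thus False using det by simp
      qed
      have "filterlim (\<lambda>x. (a * x + b) / (c * x + d)) at_infinity (at z)"
      proof (rule filterlim_divide_at_infinity[where c = "a * z + b"])
        show "((\<lambda>x. a * x + b) \<longlongrightarrow> a * z + b) (at z)" by (intro tendsto_intros)
        show "filterlim (\<lambda>x. c * x + d) (at 0) (at z)"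
        proof (rule filterlim_atI)
          show "((\<lambda>x. c * x + d) \<longlongrightarrow> 0) (at z)" unfolding z0[symmetric] by (intro tendsto_intros)
          have "c * x + d \<noteq> 0" if "x \<noteq> z" for x
          proof
            assume "c * x + d = 0"
            hence "c * x = c * z" using z0 by (metis add_right_cancel)
            thus False using \<open>c \<noteq> 0\<close> that by simp
          qed
          thus "\<forall>\<^sub>F x in at z. c * x + d \<noteq> 0" by (auto simp: eventually_at_filter)
        qed
      qed (use az in auto)
      hence "\<forall>\<^sub>F x in at z. cmod ((a * x + b) / (c * x + d)) \<ge> 1"
        by (simp add: filterlim_at_infinity[of 0])
      moreover have "\<forall>\<^sub>F x in at z. x \<in> ball 0 1" using z1 by (intro eventually_at_in_open') auto
      ultimately have "\<forall>\<^sub>F x in at z. False"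
      proof eventually_elim
        case (elim x)
        hence "\<phi> x \<in> ball 0 1" using self by blast
        thus ?case using elim by (simp add: \<phi>)
      qed
      thus False by simp
    qed
    have "(\<eta> * (p - 1)) * (c * z + d) = (a * z + b) * (p + 1)"
      using p(2) zden p1 by (simp add: \<phi> cayley_inv_def field_simps)
    hence peq: "p * (\<eta> * (c * z + d) - (a * z + b)) = \<eta> * (c * z + d) + (a * z + b)"
      by (simp add: algebra_simps)
    have zu: "z * (u + 1) = \<zeta> * (u - 1)" using u1 by (simp add: z_def cayley_inv_def)
    \<comment> \<open>By \<open>fixp\<close> the terms in \<open>u\<close> cancel. A constant
      denominator is what makes the conjugated map affine.\<close>
    have L: "(u + 1) * (\<eta> * (c * z + d) - (a * z + b)) = 2 * \<zeta> * (a - \<eta> * c)"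
    proof -
      have "(u + 1) * (\<eta> * (c * z + d) - (a * z + b)) = (\<eta> * c - a) * (z * (u + 1)) + (\<eta> * d - b) * (u + 1)"
        by (simp add: algebra_simps)
      also have "\<eta> * d - b = (a - \<eta> * c) * \<zeta>" using fixp by (simp add: algebra_simps)
      finally show ?thesis unfolding zu by (simp add: algebra_simps)
    qed
    have Rr: "(u + 1) * (\<eta> * (c * z + d) + (a * z + b)) = 2 * \<zeta> * (a - \<eta> * c) * (s * u + e)"
    proof -
      have "(u + 1) * (\<eta> * (c * z + d) + (a * z + b)) = (\<eta> * c + a) * (z * (u + 1)) + (\<eta> * d + b) * (u + 1)"
        by (simp add: algebra_simps)
      also have "\<dots> = (\<eta> * (c * \<zeta> + d) + (a * \<zeta> + b)) * u + (\<eta> * d + b - (\<eta> * c + a) * \<zeta>)"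
        unfolding zu by (simp add: algebra_simps)
      also have "\<dots> = 2 * (\<eta> * (c * \<zeta> + d)) * u + (\<eta> * d + b - (\<eta> * c + a) * \<zeta>)"
        unfolding fixp by simp
      also have "\<dots> = 2 * \<zeta> * (a - \<eta> * c) * (s * u + e)"
        using nz nz2 by (simp add: s_def e_def distrib_left)
      finally show ?thesis .
    qed
    have "p * (2 * \<zeta> * (a - \<eta> * c)) = (u + 1) * (p * (\<eta> * (c * z + d) - (a * z + b)))"
      unfolding L[symmetric] by (simp only: mult_ac)
    also have "\<dots> = 2 * \<zeta> * (a - \<eta> * c) * (s * u + e)" unfolding peq Rr ..
    finally have "p = s * u + e" using nz nz2 by simp
    thus ?thesis using p by (simp add: z_def)
  qed
  note sl = affine_half_plane_slope[of s e, OF conjunct1[OF main] s0]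
  have sr: "complex_of_real (Re s) = s" using sl(1) by (rule sym)
  show ?thesis
    using sl(2) sd main unfolding \<eta>_def by (intro exI[of _ "Re s"] exI[of _ e]) (simp only: sr, simp)
qed

section \<open>Noncompactness\<close>

text \<open>The denominator is at least (1 - |z|)^(n+1) for every \<open>v k\<close>, and the
  condition on \<gamma> gives the numerator a positive power of 1 - |v k|^2.\<close>

lemma peak_fun_tendsto_zero:
  assumes \<gamma>: "\<gamma> < 2 * real (Suc n)" and v: "\<And>k. cmod (v k) < 1" and lim: "(\<lambda>k. (cmod (v k))\<^sup>2) \<longlonglongrightarrow> 1"
    and z: "cmod z < 1"
  shows "(\<lambda>k. peak_fun \<gamma> n (v k) z) \<longlonglongrightarrow> 0"
proof (rule Lim_null_comparison)
  define e where "e = real (Suc n) - \<gamma> / 2"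
  have e: "e > 0" using \<gamma> by (simp add: e_def)
  show "\<forall>\<^sub>F k in sequentially. norm (peak_fun \<gamma> n (v k) z) \<le> (1 - (cmod (v k))\<^sup>2) powr e / 2 ^ n / (1 - cmod z) ^ Suc n"
  proof (intro always_eventually allI)
    fix k
    have "cmod (v k) * cmod z \<le> 1 * cmod z" using v[of k] by (intro mult_right_mono) auto
    hence "1 - cmod z \<le> cmod (1 - cnj (v k) * z)"
      using norm_triangle_ineq2[of 1 "cnj (v k) * z"] by (simp add: norm_mult)
    hence "(1 - cmod z) ^ Suc n \<le> cmod (1 - cnj (v k) * z) ^ Suc n" using z by (intro power_mono) auto
    moreover have "(1 - cmod z) ^ Suc n > 0" using z by simp
    ultimately show "norm (peak_fun \<gamma> n (v k) z) \<le> (1 - (cmod (v k))\<^sup>2) powr e / 2 ^ n / (1 - cmod z) ^ Suc n"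
      unfolding peak_fun_def e_def[symmetric] norm_divide norm_power norm_of_real
      by (intro frac_le) (auto simp: abs_of_nonneg)
  qed
  have "(\<lambda>k. (1 - (cmod (v k))\<^sup>2) powr e) \<longlonglongrightarrow> 0"
  proof (rule tendsto_zero_powrI)
    show "(\<lambda>k. 1 - (cmod (v k))\<^sup>2) \<longlonglongrightarrow> 0" using tendsto_diff[OF tendsto_const[of 1] lim] by simp
    show "\<forall>\<^sub>F k in sequentially. 0 \<le> 1 - (cmod (v k))\<^sup>2"
      using v by (intro always_eventually) (simp add: abs_square_le_1 less_imp_le)
  qed (use e in auto)
  from tendsto_divide[OF tendsto_divide[OF this tendsto_const[of "2 ^ n"]] tendsto_const[of "(1 - cmod z) ^ Suc n"]]
  show "(\<lambda>k. (1 - (cmod (v k))\<^sup>2) powr e / 2 ^ n / (1 - cmod z) ^ Suc n) \<longlonglongrightarrow> 0" using z by simp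
qed

text \<open>With D = 1 - |v|^2, the value at the peak is D^(-\<gamma>/2) / 2^n, and the value at
  \<open>v'\<close> is this times the power \<open>Suc n\<close> of the kernel quotient. The weight
  D^\<gamma> removes the common size, so only the quotient needs control.\<close>

lemma peak_fun_diff_norm:
  assumes v: "cmod v < 1" and v': "cmod v' < 1"
  shows "(cmod (peak_fun \<gamma> n v v - peak_fun \<gamma> n v v'))\<^sup>2 * (1 - (cmod v)\<^sup>2) powr \<gamma> =
    (cmod (1 - (of_real (1 - (cmod v)\<^sup>2) / (1 - cnj v * v')) ^ Suc n))\<^sup>2 / 4 ^ n"
proof -
  define D where "D = 1 - (cmod v)\<^sup>2"
  have D: "D > 0" using v by (simp add: D_def abs_square_less_1)
  have vv: "1 - cnj v * v = of_real D"
    using complex_norm_square[of v] by (simp add: D_def mult.commute)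
  define q where "q = of_real D / (1 - cnj v * v')"
  define e where "e = D powr (real (Suc n) - \<gamma> / 2) / 2 ^ n"
  have "peak_fun \<gamma> n v v - peak_fun \<gamma> n v v' = of_real e / of_real D ^ Suc n * (1 - q ^ Suc n)"
    unfolding peak_fun_def D_def[symmetric] e_def[symmetric] vv q_def power_divide
    using D by (simp add: right_diff_distrib)
  also have "of_real e / of_real D ^ Suc n = (of_real (e / D ^ Suc n) :: complex)" by simp
  also have "e / D ^ Suc n = D powr (- \<gamma> / 2) / 2 ^ n"
  proof -
    have "D powr (real (Suc n) - \<gamma> / 2) = D ^ Suc n * D powr (- \<gamma> / 2)"
      using powr_add[of D "real (Suc n)" "- \<gamma> / 2"] powr_realpow[OF D, of "Suc n"] by simp
    thus ?thesis using D by (simp only: e_def) (simp del: power_Suc)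
  qed
  finally have "(cmod (peak_fun \<gamma> n v v - peak_fun \<gamma> n v v'))\<^sup>2 =
     (D powr (- \<gamma> / 2) / 2 ^ n)\<^sup>2 * (cmod (1 - q ^ Suc n))\<^sup>2"
    by (simp only: norm_mult norm_of_real power_mult_distrib power2_abs)
  also have "(D powr (- \<gamma> / 2) / 2 ^ n)\<^sup>2 = D powr (- \<gamma>) / 4 ^ n"
  proof -
    have "((2::real) ^ n)\<^sup>2 = 4 ^ n" by (simp flip: power_mult power_mult_distrib add: power2_eq_square)
    thus ?thesis using D by (simp add: power_divide powr_power)
  qed
  finally show ?thesis unfolding D_def[symmetric] q_def[symmetric]
    using D by (simp add: powr_minus)
qed

text \<open>The functional-analytic core, stated for any space with these three properties. A norm
  limit \<open>g\<close> of images of peak functions must vanish on the disc, yet the images stay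
  large at the points \<open>w k\<close>.\<close>

lemma not_compact_comp_op_diff:
  fixes mem :: "(complex \<Rightarrow> complex) \<Rightarrow> bool" and nrm :: "(complex \<Rightarrow> complex) \<Rightarrow> real"
  assumes diff: "\<And>F G. mem F \<Longrightarrow> mem G \<Longrightarrow> mem (F - G)"
    and eval: "\<And>h w. mem h \<Longrightarrow> cmod w < 1 \<Longrightarrow> (cmod (h w))\<^sup>2 * (1 - cmod w) powr \<gamma> \<le> C * (nrm h)\<^sup>2"
    and peak: "\<And>v. cmod v < 1 \<Longrightarrow> mem (peak_fun \<gamma> n v)" "\<And>v. cmod v < 1 \<Longrightarrow> nrm (peak_fun \<gamma> n v) \<le> 1"
    and \<gamma>: "0 < \<gamma>" "\<gamma> < 2 * real (Suc n)"
    and self: "\<And>z. cmod z < 1 \<Longrightarrow> cmod (\<phi> z) < 1" "\<And>z. cmod z < 1 \<Longrightarrow> cmod (\<psi> z) < 1"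
    and w: "\<And>k. cmod (w k) < 1"
    and v: "\<And>k. (v k = \<phi> (w k) \<and> v' k = \<psi> (w k)) \<or> (v k = \<psi> (w k) \<and> v' k = \<phi> (w k))"
    and lim: "(\<lambda>k. (cmod (v k))\<^sup>2) \<longlonglongrightarrow> 1"
    and c: "c > 0" "\<forall>\<^sub>F k in sequentially. c * (1 - (cmod (v k))\<^sup>2) \<le> 1 - cmod (w k)"
    and Q: "(\<lambda>k. of_real (1 - (cmod (v k))\<^sup>2) / (1 - cnj (v k) * v' k)) \<longlonglongrightarrow> Q" "cmod Q < 1"
  shows "\<not> compact_op_on mem nrm (\<lambda>f. comp_op \<phi> f - comp_op \<psi> f)"
proof
  define T where "T f = comp_op \<phi> f - comp_op \<psi> f" for f
  assume "compact_op_on mem nrm (\<lambda>f. comp_op \<phi> f - comp_op \<psi> f)"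
  hence cpt: "compact_op_on mem nrm T" by (simp add: T_def[abs_def])
  have v1: "cmod (v k) < 1" "cmod (v' k) < 1" for k using v[of k] self w by auto
  define f where "f k = peak_fun \<gamma> n (v k)" for k
  have "\<forall>k. mem (f k) \<and> nrm (f k) \<le> 1" using peak v1 by (simp add: f_def)
  then obtain r g where r: "strict_mono r" and g: "mem g" and conv: "(\<lambda>k. nrm (T (f (r k)) - g)) \<longlonglongrightarrow> 0"
    using cpt unfolding compact_op_on_def by blast
  have memT: "mem (T (f k))" for k
    using cpt peak v1 unfolding compact_op_on_def by (simp add: f_def)
  define h where "h k = T (f (r k)) - g" for k
  have memh: "mem (h k)" for k unfolding h_def by (intro diff memT g)
  have nrm0: "(\<lambda>k. C * (nrm (h k))\<^sup>2) \<longlonglongrightarrow> 0"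
    using tendsto_mult[OF tendsto_const[of C] tendsto_power[OF conv, of 2]] by (simp add: h_def)
  \<comment> \<open>Norm convergence implies pointwise convergence by \<open>eval\<close>, and the
    images themselves tend to 0 pointwise.\<close>
  have g0: "g z = 0" if z: "cmod z < 1" for z
  proof -
    have "(\<lambda>k. (cmod (h k z))\<^sup>2) \<longlonglongrightarrow> 0"
    proof (rule Lim_null_comparison)
      have "(cmod (h k z))\<^sup>2 \<le> C * (nrm (h k))\<^sup>2 / (1 - cmod z) powr \<gamma>" for k
        using eval[OF memh z, of k] z by (simp add: pos_le_divide_eq)
      thus "\<forall>\<^sub>F k in sequentially. norm ((cmod (h k z))\<^sup>2) \<le> C * (nrm (h k))\<^sup>2 / (1 - cmod z) powr \<gamma>"
        by (intro always_eventually) simp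
      show "(\<lambda>k. C * (nrm (h k))\<^sup>2 / (1 - cmod z) powr \<gamma>) \<longlonglongrightarrow> 0"
        using tendsto_divide[OF nrm0 tendsto_const[of "(1 - cmod z) powr \<gamma>"]] z by simp
    qed
    from tendsto_real_sqrt[OF this] have h0: "(\<lambda>k. h k z) \<longlonglongrightarrow> 0"
      by (simp add: tendsto_norm_zero_iff)
    have "(\<lambda>k. f k (\<phi> z) - f k (\<psi> z)) \<longlonglongrightarrow> 0 - 0"
      unfolding f_def using \<gamma> v1 lim self[OF z] by (intro tendsto_diff peak_fun_tendsto_zero) auto
    hence "(\<lambda>k. f (r k) (\<phi> z) - f (r k) (\<psi> z)) \<longlonglongrightarrow> 0"
      using LIMSEQ_subseq_LIMSEQ[OF _ r] by (fastforce simp: o_def)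
    from tendsto_diff[OF this h0] have "(\<lambda>k. g z) \<longlonglongrightarrow> 0"
      by (simp add: h_def T_def comp_op_def)
    thus ?thesis by (simp add: LIMSEQ_const_iff)
  qed
  \<comment> \<open>A lower bound for \<open>C * (nrm (h k))^2\<close> from evaluating
    \<open>h k\<close> at \<open>w (r k)\<close>, where \<open>g\<close> vanishes;
    \<open>c powr \<gamma>\<close> is the cost of replacing 1 - |w|, the weight in
    \<open>eval\<close>, by 1 - |v|^2.\<close>
  define E where "E k = (cmod (1 - (of_real (1 - (cmod (v k))\<^sup>2) / (1 - cnj (v k) * v' k)) ^ Suc n))\<^sup>2 / 4 ^ n * c powr \<gamma>" for k
  have Elim: "E \<longlonglongrightarrow> (cmod (1 - Q ^ Suc n))\<^sup>2 / 4 ^ n * c powr \<gamma>"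
    unfolding E_def by (intro tendsto_intros Q) auto
  have Ele: "\<forall>\<^sub>F k in sequentially. E (r k) \<le> C * (nrm (h k))\<^sup>2"
    using eventually_subseq[OF r c(2)]
  proof eventually_elim
    case (elim k)
    define j where "j = r k"
    have D: "1 - (cmod (v j))\<^sup>2 > 0" using v1[of j] by (simp add: abs_square_less_1)
    have "h k (w j) = f j (\<phi> (w j)) - f j (\<psi> (w j))"
      using g0[OF w] by (simp add: h_def T_def comp_op_def j_def)
    hence hk: "cmod (h k (w j)) = cmod (peak_fun \<gamma> n (v j) (v j) - peak_fun \<gamma> n (v j) (v' j))"
      using v[of j] by (auto simp: f_def norm_minus_commute)
    have "E j = (cmod (h k (w j)))\<^sup>2 * ((1 - (cmod (v j))\<^sup>2) powr \<gamma> * c powr \<gamma>)"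
      unfolding E_def hk using peak_fun_diff_norm[OF v1, of \<gamma> n j j] by (simp add: mult.assoc[symmetric])
    also have "(1 - (cmod (v j))\<^sup>2) powr \<gamma> * c powr \<gamma> = (c * (1 - (cmod (v j))\<^sup>2)) powr \<gamma>"
      using D c by (subst powr_mult) auto
    also have "(cmod (h k (w j)))\<^sup>2 * \<dots> \<le> (cmod (h k (w j)))\<^sup>2 * (1 - cmod (w j)) powr \<gamma>"
      using elim D c \<gamma> by (intro mult_left_mono powr_mono2) (auto simp: j_def)
    also have "\<dots> \<le> C * (nrm (h k))\<^sup>2" by (rule eval[OF memh w])
    finally show ?case by (simp add: j_def)
  qed
  have "(cmod (1 - Q ^ Suc n))\<^sup>2 / 4 ^ n * c powr \<gamma> \<le> 0"
    by (rule tendsto_le[OF _ nrm0 LIMSEQ_subseq_LIMSEQ[OF Elim r, unfolded o_def] Ele]) simp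
  \<comment> \<open>The assumption |Q| < 1, rather than Q different from 1, serves every
    \<open>n\<close> at once.\<close>
  moreover have "1 - Q ^ Suc n \<noteq> 0"
  proof
    assume "1 - Q ^ Suc n = 0"
    hence "cmod Q ^ Suc n = 1" by (metis eq_iff_diff_eq_0 norm_one norm_power)
    thus False using Q(2) power_Suc_less_one[of "cmod Q" n] by (cases "cmod Q = 0") auto
  qed
  hence "(cmod (1 - Q ^ Suc n))\<^sup>2 / 4 ^ n * c powr \<gamma> > 0"
    using c by (intro mult_pos_pos divide_pos_pos) auto
  ultimately show False by linarith
qed

section \<open>Choice of the points on the horocycle\<close>

text \<open>On \<open>Re u = 1\<close> the sum \<open>cnj (P k) + P' k\<close> is a constant
  \<open>m\<close>, so the kernel quotient is \<open>Q = 2 (s + Re a) / m\<close> times a factor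
  tending to 1. The order of the real parts makes its numerator the smaller one in modulus.\<close>

lemma peak_points:
  assumes \<zeta>: "cmod \<zeta> = 1" and \<eta>: "cmod \<eta> = 1" and s: "s > 0"
    and p: "\<And>u. Re u > 0 \<Longrightarrow> Re (of_real s * u + a) > 0" and p': "\<And>u. Re u > 0 \<Longrightarrow> Re (of_real s * u + b) > 0"
    and ab: "a \<noteq> b" "Re a \<le> Re b"
  defines "U k \<equiv> Complex 1 (real k)"
  defines "w k \<equiv> cayley_inv \<zeta> (U k)" and "v k \<equiv> cayley_inv \<eta> (of_real s * U k + a)"
    and "v' k \<equiv> cayley_inv \<eta> (of_real s * U k + b)"
  shows "\<exists>c Q. (\<lambda>k. (cmod (v k))\<^sup>2) \<longlonglongrightarrow> 1 \<and> c > 0 \<and>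
     (\<forall>\<^sub>F k in sequentially. c * (1 - (cmod (v k))\<^sup>2) \<le> 1 - cmod (w k)) \<and>
     (\<lambda>k. of_real (1 - (cmod (v k))\<^sup>2) / (1 - cnj (v k) * v' k)) \<longlonglongrightarrow> Q \<and> cmod Q < 1"
proof -
  define P where "P k = of_real s * U k + a" for k
  define P' where "P' k = of_real s * U k + b" for k
  have ReU: "Re (U k) > 0" for k by (simp add: U_def)
  have ReP: "Re (P k) = s + Re a" for k by (simp add: P_def U_def)
  have A: "s + Re a > 0" using p[OF ReU[of 0]] by (simp add: U_def)
  have B: "Re (P' k) > 0" for k using p'[OF ReU[of k]] by (simp add: P'_def)
  have nz: "U k + 1 \<noteq> 0" "P k + 1 \<noteq> 0" "P' k + 1 \<noteq> 0" for k
    using ReU[of k] ReP[of k] A B[of k] Re_pos_add_one_nonzero by auto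
  have inf: "filterlim (\<lambda>k. U k + 1) at_infinity sequentially"
  proof (rule filterlim_norm_at_top_imp_at_infinity)
    show "filterlim (\<lambda>k. norm (U k + 1)) at_top sequentially"
    proof (rule filterlim_at_top_mono[OF filterlim_real_sequentially])
      have "real k \<le> cmod (U k + 1)" for k using abs_Im_le_cmod[of "U k + 1"] by (simp add: U_def)
      thus "\<forall>\<^sub>F k in sequentially. real k \<le> cmod (U k + 1)" by simp
    qed
  qed
  have quot: "(\<lambda>k. (of_real s * U k + x + 1) / (U k + 1)) \<longlonglongrightarrow> of_real s" for x
  proof -
    have "(\<lambda>k. of_real s + (x + 1 - of_real s) / (U k + 1)) \<longlonglongrightarrow> of_real s + 0"
      by (intro tendsto_intros tendsto_divide_0[OF tendsto_const inf])
    moreover have "of_real s + (x + 1 - of_real s) / (U k + 1) = (of_real s * U k + x + 1) / (U k + 1)" for k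
      using nz(1)[of k] by (simp add: field_simps)
    ultimately show ?thesis by simp
  qed
  have quotP: "(\<lambda>k. (P k + 1) / (U k + 1)) \<longlonglongrightarrow> of_real s" and quotP': "(\<lambda>k. (P' k + 1) / (U k + 1)) \<longlonglongrightarrow> of_real s"
    using quot[of a] quot[of b] by (simp_all add: P_def P'_def)
  have Dv: "1 - (cmod (v k))\<^sup>2 = 4 * (s + Re a) / (cmod (P k + 1))\<^sup>2" for k
    using one_minus_norm_cayley_inv[OF \<eta>, of "P k"] A unfolding v_def P_def[symmetric] ReP by simp
  have Dw: "1 - (cmod (w k))\<^sup>2 = 4 / (cmod (U k + 1))\<^sup>2" for k
    using one_minus_norm_cayley_inv[OF \<zeta> ReU, of k] by (simp add: w_def U_def)
  have Pinf: "filterlim (\<lambda>k. P k + 1) at_infinity sequentially"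
  proof -
    have "filterlim (\<lambda>k. (P k + 1) / (U k + 1) * (U k + 1)) at_infinity sequentially"
      using s by (intro tendsto_mult_filterlim_at_infinity[OF quotP _ inf]) auto
    thus ?thesis using nz(1) by simp
  qed
  have lim1: "(\<lambda>k. (cmod (v k))\<^sup>2) \<longlonglongrightarrow> 1"
  proof -
    have "(\<lambda>k. 1 - 4 * (s + Re a) * (cmod (1 / (P k + 1)))\<^sup>2) \<longlonglongrightarrow> 1 - 4 * (s + Re a) * (cmod 0)\<^sup>2"
      by (intro tendsto_intros tendsto_divide_0[OF tendsto_const Pinf])
    moreover have "1 - 4 * (s + Re a) * (cmod (1 / (P k + 1)))\<^sup>2 = (cmod (v k))\<^sup>2" for k
      using Dv[of k] by (simp add: norm_divide power_divide)
    ultimately show ?thesis by simp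
  qed
  \<comment> \<open>Combines 1 - |w| >= (1 - |w|^2) / 2 = 2 / |U + 1|^2 with |P + 1| > (s/2) |U +
    1|, which holds eventually, and with the formula \<open>Dv\<close>.\<close>
  define c where "c = (s / 2)\<^sup>2 / (2 * (s + Re a))"
  have c: "c > 0" using A s by (simp add: c_def)
  have ev: "\<forall>\<^sub>F k in sequentially. c * (1 - (cmod (v k))\<^sup>2) \<le> 1 - cmod (w k)"
  proof -
    have "(\<lambda>k. cmod ((P k + 1) / (U k + 1))) \<longlonglongrightarrow> s"
      using tendsto_norm[OF quotP] s by simp
    hence "\<forall>\<^sub>F k in sequentially. cmod ((P k + 1) / (U k + 1)) > s / 2"
      using s by (intro order_tendstoD) auto
    thus ?thesis
    proof eventually_elim
      case (elim k)
      have "(s / 2)\<^sup>2 \<le> (cmod ((P k + 1) / (U k + 1)))\<^sup>2" using elim s by (intro power_mono) auto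
      hence "(s / 2)\<^sup>2 / (cmod (P k + 1))\<^sup>2 \<le> 1 / (cmod (U k + 1))\<^sup>2"
        using nz[of k] by (simp add: norm_divide power_divide field_simps)
      hence "2 * ((s / 2)\<^sup>2 / (cmod (P k + 1))\<^sup>2) \<le> (1 - (cmod (w k))\<^sup>2) / 2"
        unfolding Dw by simp
      also have "\<dots> \<le> 1 - cmod (w k)"
      proof -
        have "0 \<le> (1 - cmod (w k))\<^sup>2" by simp
        hence "2 * cmod (w k) \<le> 1 + (cmod (w k))\<^sup>2" by (simp add: power2_eq_square algebra_simps)
        thus ?thesis by (simp add: field_simps)
      qed
      also have "2 * ((s / 2)\<^sup>2 / (cmod (P k + 1))\<^sup>2) = c * (1 - (cmod (v k))\<^sup>2)"
      proof -
        have "2 * (x / y) = x / (2 * t) * (4 * t / y)" if "t > 0" for x y t :: real using that by simp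
        from this[OF A] show ?thesis unfolding Dv c_def .
      qed
      finally show ?case .
    qed
  qed
  define m where "m = 2 * of_real s + cnj a + b"
  define Q where "Q = of_real (2 * (s + Re a)) / m"
  have cm: "cnj (P k) + P' k = m" for k
    by (simp add: P_def P'_def m_def U_def complex_eq_iff)
  have Rem: "Re m = 2 * s + Re a + Re b" and Imm: "Im m = Im b - Im a" by (simp_all add: m_def)
  have mpos: "Re m > 0" using Rem A ab by linarith
  have m0: "m \<noteq> 0" using mpos by auto
  \<comment> \<open>If the real parts differ, Re m alone is large enough; if they agree, a \<noteq>
    b gives \<open>m\<close> a nonzero imaginary part.\<close>
  have big: "2 * (s + Re a) < cmod m"
  proof (cases "Re a = Re b")
    case True
    hence "Im m \<noteq> 0" using ab Imm by (auto simp: complex_eq_iff)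
    hence "(Re m)\<^sup>2 < (cmod m)\<^sup>2" by (simp add: cmod_power2)
    hence "Re m < cmod m" by (rule power2_less_imp_less) simp
    thus ?thesis using Rem True by simp
  next
    case False
    hence "Re a < Re b" using ab by simp
    hence "2 * (s + Re a) < Re m" by (simp add: Rem)
    thus ?thesis using complex_Re_le_cmod by (rule less_le_trans)
  qed
  have Qlt: "cmod Q < 1" using A big m0 unfolding Q_def norm_divide norm_of_real by simp
  \<comment> \<open>The leftover factor is (P' + 1) / (P + 1); it is written through U + 1 because
    both quotients by U + 1 tend to \<open>s\<close>.\<close>
  have q: "of_real (1 - (cmod (v k))\<^sup>2) / (1 - cnj (v k) * v' k) = Q * (((P' k + 1) / (U k + 1)) / ((P k + 1) / (U k + 1)))" for k
  proof -
    have e: "1 - cnj (v k) * v' k = 2 * m / (cnj (P k + 1) * (P' k + 1))"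
      using one_minus_cnj_cayley_inv[OF \<eta>, of "P k" "P' k"] A B[of k]
      unfolding v_def v'_def P_def[symmetric] P'_def[symmetric] ReP cm by simp
    have Dv': "of_real (1 - (cmod (v k))\<^sup>2) = 4 * of_real (s + Re a) / ((P k + 1) * cnj (P k + 1))"
      unfolding Dv using complex_norm_square[of "P k + 1"] by simp
    have "cnj (P k + 1) \<noteq> 0" using nz(2)[of k] by (simp only: complex_cnj_zero_iff) simp
    moreover have alg: "4 * t / (x * y) / (2 * m / (y * x')) = (2 * t / m) * ((x' / z) / (x / z))"
      if "x \<noteq> 0" "y \<noteq> 0" "x' \<noteq> 0" "z \<noteq> 0" for x y x' z t :: complex
      using that m0 by (simp add: field_simps)
    ultimately show ?thesis using nz[of k] unfolding e Dv' Q_def of_real_mult of_real_numeral by (intro alg)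
  qed
  have "(\<lambda>k. Q * (((P' k + 1) / (U k + 1)) / ((P k + 1) / (U k + 1)))) \<longlonglongrightarrow> Q * (of_real s / of_real s)"
    using s by (intro tendsto_intros quotP quotP') auto
  hence "(\<lambda>k. of_real (1 - (cmod (v k))\<^sup>2) / (1 - cnj (v k) * v' k)) \<longlonglongrightarrow> Q"
    using s by (simp only: q) simp
  thus ?thesis using lim1 c ev Qlt by blast
qed

text \<open>Equal values and derivatives at \<zeta> give one slope \<open>s\<close>; equal
  translation constants would make the maps coincide on the disc. The alternative in the conclusion
  records which map has the smaller real part and therefore carries the peak.\<close>

lemma lf_selfmap_peak_points:
  assumes \<phi>: "lf_selfmap \<phi>" and \<psi>: "lf_selfmap \<psi>" and \<zeta>: "cmod \<zeta> = 1"
    and eq: "\<phi> \<zeta> = \<psi> \<zeta>" and \<eta>: "cmod (\<phi> \<zeta>) = 1" and der: "deriv \<phi> \<zeta> = deriv \<psi> \<zeta>"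
    and ne: "\<exists>z\<in>ball 0 1. \<phi> z \<noteq> \<psi> z"
  obtains w v v' c Q where "\<And>k. cmod (w k) < 1"
    "\<And>k. (v k = \<phi> (w k) \<and> v' k = \<psi> (w k)) \<or> (v k = \<psi> (w k) \<and> v' k = \<phi> (w k))"
    "(\<lambda>k. (cmod (v k))\<^sup>2) \<longlonglongrightarrow> 1"
    "c > 0" "\<forall>\<^sub>F k in sequentially. c * (1 - (cmod (v k))\<^sup>2) \<le> 1 - cmod (w k)"
    "(\<lambda>k. of_real (1 - (cmod (v k))\<^sup>2) / (1 - cnj (v k) * v' k)) \<longlonglongrightarrow> Q" "cmod Q < 1"
proof -
  obtain s a where s: "s > 0" "\<phi> \<zeta> = of_real s * \<zeta> * deriv \<phi> \<zeta>"
    and a: "\<And>u. Re u > 0 \<Longrightarrow> Re (of_real s * u + a) > 0"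
    "\<And>u. Re u > 0 \<Longrightarrow> \<phi> (cayley_inv \<zeta> u) = cayley_inv (\<phi> \<zeta>) (of_real s * u + a)"
    using lf_selfmap_half_plane[OF \<phi> \<zeta> \<eta>] by blast
  obtain s' b where s': "s' > 0" "\<psi> \<zeta> = of_real s' * \<zeta> * deriv \<psi> \<zeta>"
    and b': "\<And>u. Re u > 0 \<Longrightarrow> Re (of_real s' * u + b) > 0"
    "\<And>u. Re u > 0 \<Longrightarrow> \<psi> (cayley_inv \<zeta> u) = cayley_inv (\<phi> \<zeta>) (of_real s' * u + b)"
    using lf_selfmap_half_plane[OF \<psi> \<zeta>] \<eta> eq by force
  have "\<phi> \<zeta> \<noteq> 0" using \<eta> by auto
  hence "\<zeta> * deriv \<phi> \<zeta> \<noteq> 0" using s(2) by auto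
  moreover have "of_real s * (\<zeta> * deriv \<phi> \<zeta>) = of_real s' * (\<zeta> * deriv \<phi> \<zeta>)"
    using s(2) s'(2) eq der by (metis mult.assoc)
  ultimately have "s' = s" by simp
  note b = b'[unfolded this]
  have ab: "a \<noteq> b"
  proof
    assume "a = b"
    hence "\<phi> z = \<psi> z" if "cmod z < 1" for z
      using cayley_inv_surj[OF \<zeta> that] a(2) b(2) by auto
    thus False using ne by auto
  qed
  define U where "U k = Complex 1 (real k)" for k
  define w where "w k = cayley_inv \<zeta> (U k)" for k
  have U: "Re (U k) > 0" for k by (simp add: U_def)
  have w: "cmod (w k) < 1" for k unfolding w_def by (rule norm_cayley_inv_less_one[OF \<zeta> U])
  have \<phi>w: "\<phi> (w k) = cayley_inv (\<phi> \<zeta>) (of_real s * U k + a)"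
    and \<psi>w: "\<psi> (w k) = cayley_inv (\<phi> \<zeta>) (of_real s * U k + b)" for k
    unfolding w_def by (rule a(2)[OF U] b(2)[OF U])+
  show ?thesis
  proof (cases "Re a \<le> Re b")
    case True
    from peak_points[OF \<zeta> \<eta> s(1) a(1) b(1) ab True, folded U_def, folded w_def \<phi>w \<psi>w]
    show ?thesis using that[of w "\<lambda>k. \<phi> (w k)" "\<lambda>k. \<psi> (w k)"] w by blast
  next
    case False
    hence "Re b \<le> Re a" by simp
    from peak_points[OF \<zeta> \<eta> s(1) b(1) a(1) ab[symmetric] this, folded U_def, folded w_def \<phi>w \<psi>w]
    show ?thesis using that[of w "\<lambda>k. \<psi> (w k)" "\<lambda>k. \<phi> (w k)"] w by blast
  qed
qed

theorem theorem3:
  fixes \<phi> \<psi> :: "complex \<Rightarrow> complex" and \<zeta> :: complex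
  assumes "lf_selfmap \<phi>" and "lf_selfmap \<psi>"
    and "\<not> disc_automorphism \<phi>" and "\<not> disc_automorphism \<psi>"
    and "cmod \<zeta> = 1"
    and "\<phi> \<zeta> = \<psi> \<zeta>" and "cmod (\<phi> \<zeta>) = 1"
    and "deriv \<phi> \<zeta> = deriv \<psi> \<zeta>"
    and "\<exists>z\<in>ball 0 1. \<phi> z \<noteq> \<psi> z"
  shows "\<not> compact_op_on in_H2 H2_norm (\<lambda>f. comp_op \<phi> f - comp_op \<psi> f)
       \<and> (\<forall>\<alpha>::real. \<alpha> > -1 \<longrightarrow>
            \<not> compact_op_on (in_A2 \<alpha>) (A2_norm \<alpha>) (\<lambda>f. comp_op \<phi> f - comp_op \<psi> f))"
proof -
  have self: "cmod (\<phi> z) < 1" "cmod (\<psi> z) < 1" if "cmod z < 1" for z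
    using assms(1,2) that unfolding lf_selfmap_def image_subset_iff by auto
  obtain w v v' c Q where pts: "\<And>k. cmod (w k) < 1"
    "\<And>k. (v k = \<phi> (w k) \<and> v' k = \<psi> (w k)) \<or> (v k = \<psi> (w k) \<and> v' k = \<phi> (w k))"
    "(\<lambda>k. (cmod (v k))\<^sup>2) \<longlonglongrightarrow> 1"
    "c > 0" "\<forall>\<^sub>F k in sequentially. c * (1 - (cmod (v k))\<^sup>2) \<le> 1 - cmod (w k)"
    "(\<lambda>k. of_real (1 - (cmod (v k))\<^sup>2) / (1 - cnj (v k) * v' k)) \<longlonglongrightarrow> Q" "cmod Q < 1"
    using lf_selfmap_peak_points[OF assms(1,2,5-9)] by blast
  show ?thesis
  proof (intro conjI allI impI)
    show "\<not> compact_op_on in_H2 H2_norm (\<lambda>f. comp_op \<phi> f - comp_op \<psi> f)"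
    proof (rule not_compact_comp_op_diff[where mem=in_H2 and nrm=H2_norm and \<gamma>=1 and n=0
        and \<phi>=\<phi> and \<psi>=\<psi> and w=w and v=v and v'=v' and c=c and Q=Q,
        OF in_H2_diff _ peak_fun_H2 _ _ self pts])
      show "(cmod (h w))\<^sup>2 * (1 - cmod w) powr 1 \<le> 2 * (H2_norm h)\<^sup>2" if "in_H2 h" "cmod w < 1" for h w
        using H2_eval[OF that] that by simp
    qed auto
  next
    fix \<alpha> :: real assume \<alpha>: "\<alpha> > -1"
    obtain C where C: "\<And>h w. in_A2 \<alpha> h \<Longrightarrow> cmod w < 1 \<Longrightarrow>
      (cmod (h w))\<^sup>2 * (1 - cmod w) powr (\<alpha> + 2) \<le> C * (A2_norm \<alpha> h)\<^sup>2"
      using A2_eval[OF \<alpha>] by blast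
    \<comment> \<open>Large enough both for the norm bound of the peak functions and for \<alpha> +
      2 < 2 (n + 1), which makes them vanish pointwise.\<close>
    obtain n :: nat where n: "\<alpha> + 2 \<le> real n" using real_arch_simple by blast
    hence n': "\<alpha> + 2 \<le> 2 * real n + 1" by simp
    show "\<not> compact_op_on (in_A2 \<alpha>) (A2_norm \<alpha>) (\<lambda>f. comp_op \<phi> f - comp_op \<psi> f)"
      by (rule not_compact_comp_op_diff[where mem="in_A2 \<alpha>" and nrm="A2_norm \<alpha>" and \<gamma>="\<alpha> + 2" and n=n
        and \<phi>=\<phi> and \<psi>=\<psi> and w=w and v=v and v'=v' and c=c and Q=Q,
        OF in_A2_diff C peak_fun_A2[OF \<alpha> n'] _ _ self pts])
         (use \<alpha> n in auto)
  qed
qed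

end
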